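(* Let $F(z)$ be a monic $p\times p$ matrix polynomial of even degree $\deg F=2m$, $m\in\mathbb N$, with even part $F_e(z)$ and odd part $F_o(z)$. Assume that the rational matrix function $R_F(z)=-F_o(z)F_e(z)^{-1}$ is self-adjoint, and let $F_o(z)$ be regular. Put $$\widetilde R_F(z)=F_e(z)F_o(z)^{-1},\qquad \widetilde R_{z,F}(z)=-z^{-1}\widetilde R_F(z)=-F_e(z)\,(zF_o(z))^{-1}.$$ Then the Hurwitz stability of $F(z)$ is equivalent to the negative definiteness of $\mathscr H_{m-2}(\widetilde R_F)$, of $\mathscr H_{m-1}(\widetilde R_{z,F})$ and of the limit $\lim_{z\to\infty}\widetilde R_{z,F}(z)$. (For $m=1$ the condition on $\mathscr H_{m-2}(\widetilde R_F)$ is void.)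
   Context: Here $p\in\mathbb N$. A $p\times p$ matrix polynomial $F(z)=\sum_{k=0}^nA_kz^{n-k}$ with $A_k\in\mathbb C^{p\times p}$, $A_0\ne0_p$, has degree $\deg F=n$; it is monic if $A_0=I_p$, and regular if $\det F\not\equiv0$. A regular $F$ is Hurwitz stable if all its zeros (the $\lambda\in\mathbb C$ with $\det F(\lambda)=0$) lie in the open left half-plane. The even part $F_e$ and odd part $F_o$ are the matrix polynomials with $F(z)=F_e(z^2)+zF_o(z^2)$; for $\deg F=2m$, $F_e(z)=\sum_{k=0}^mA_{2k}z^{m-k}$ (monic when $F$ is) and $F_o(z)=\sum_{k=1}^mA_{2k-1}z^{m-k}$. A rational matrix function $R$ (entries are complex rational functions) is self-adjoint if $R(z)=R(\bar z)^*$ for all $z\in\mathbb C$ except the poles of its entries, $^*$ being conjugate transpose. Write the Laurent series of a rational matrix function $R$ convergent for large $|z|$ as $R(z)=\sum_{j=0}^{k}z^j\mathbf s_{-(j+1)}+\sum_{j=0}^\infty \mathbf s_jz^{-(j+1)}$. For $k\in\mathbb N_0$, $\mathscr H_k(R)$ is the block Hankel matrix $[\mathbf s_{a+b}]_{a,b=0}^k$. *)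

theory Defs
  imports
    "HOL-Complex_Analysis.Complex_Analysis"
    "HOL-Computational_Algebra.Computational_Algebra"
    "HOL-Computational_Algebra.Field_as_Ring"
begin

text \<open>
  A \<open>p \<times> p\<close> matrix polynomial is a value of type \<open>(complex^'n^'n) poly\<close> with \<open>p = CARD('n)\<close>, so
  that \<open>degree\<close>, \<open>coeff\<close> and \<open>lead_coeff\<close> are the library's.  The library's \<open>poly\<close> (evaluation) is
  not usable here, because \<open>*\<close> on the type \<open>_^'n^'n\<close> is the entrywise product.
\<close>

definition mp_eval :: "(complex^'n^'n) poly \<Rightarrow> complex \<Rightarrow> complex^'n^'n" where
  "mp_eval F z = (\<Sum>k\<le>degree F. map_matrix ((*) (z ^ k)) (coeff F k))"

definition mp_monic :: "(complex^'n^'n) poly \<Rightarrow> bool" where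
  "mp_monic F \<longleftrightarrow> lead_coeff F = mat 1"

definition mp_regular :: "(complex^'n^'n) poly \<Rightarrow> bool" where
  "mp_regular F \<longleftrightarrow> (\<exists>z. det (mp_eval F z) \<noteq> 0)"

definition hurwitz_stable :: "(complex^'n^'n) poly \<Rightarrow> bool" where
  "hurwitz_stable F \<longleftrightarrow> mp_regular F \<and> (\<forall>z. det (mp_eval F z) = 0 \<longrightarrow> Re z < 0)"

definition even_part :: "(complex^'n^'n) poly \<Rightarrow> (complex^'n^'n) poly" where
  "even_part F = (\<Sum>i\<le>degree F. monom (coeff F (2 * i)) i)"

definition odd_part :: "(complex^'n^'n) poly \<Rightarrow> (complex^'n^'n) poly" where
  "odd_part F = (\<Sum>i\<le>degree F. monom (coeff F (2 * i + 1)) i)"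

lemma coeff_even_part: "coeff (even_part F) i = coeff F (2 * i)"
  by (auto simp: even_part_def coeff_sum coeff_eq_0)

lemma coeff_odd_part: "coeff (odd_part F) i = coeff F (2 * i + 1)"
  by (auto simp: odd_part_def coeff_sum coeff_eq_0)

lemma mp_eval_conv_sum:
  assumes "degree F \<le> N"
  shows "mp_eval F z = (\<Sum>k\<le>N. map_matrix ((*) (z ^ k)) (coeff F k))"
  unfolding mp_eval_def using assms
  by (intro sum.mono_neutral_left) (auto simp: coeff_eq_0 map_matrix_def vec_eq_iff)

lemma even_odd_decomposition:
  "mp_eval F z = mp_eval (even_part F) (z\<^sup>2) + map_matrix ((*) z) (mp_eval (odd_part F) (z\<^sup>2))"
proof -
  define d where "d = degree F"
  have deg: "degree (even_part F) \<le> d" "degree (odd_part F) \<le> d" "degree F \<le> 2 * d + 1"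
    by (auto simp: d_def coeff_even_part coeff_odd_part coeff_eq_0 intro!: degree_le)
  have split: "(\<Sum>k\<le>2 * n + 1. f k) = (\<Sum>k\<le>n. f (2 * k)) + (\<Sum>k\<le>n. f (2 * k + 1))"
    for f :: "nat \<Rightarrow> complex" and n
    by (induction n) (simp_all add: algebra_simps)
  have "mp_eval F z $ i $ j = (mp_eval (even_part F) (z\<^sup>2)
          + map_matrix ((*) z) (mp_eval (odd_part F) (z\<^sup>2))) $ i $ j" for i j
    unfolding deg[THEN mp_eval_conv_sum]
    using split[of "\<lambda>k. z ^ k * coeff F k $ i $ j" d]
    by (simp add: coeff_even_part coeff_odd_part sum_distrib_left power_mult power_even_eq
        mult.assoc)
  then show ?thesis
    by (simp add: vec_eq_iff)
qed


text \<open>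
  Rational matrix functions are matrices over the field \<open>complex poly fract\<close> of complex rational
  functions.  Poles and values of an entry are read off its reduced quotient \<open>quot_of_fract\<close>
  (coprime numerator and denominator), so that removable singularities are not poles.
\<close>

type_synonym ratfun = "complex poly fract"

definition rf_pole :: "ratfun \<Rightarrow> complex \<Rightarrow> bool" where
  "rf_pole r z \<longleftrightarrow> poly (snd (quot_of_fract r)) z = 0"

definition rf_eval :: "ratfun \<Rightarrow> complex \<Rightarrow> complex" where
  "rf_eval r z = poly (fst (quot_of_fract r)) z / poly (snd (quot_of_fract r)) z"

abbreviation rf_var :: ratfun where
  "rf_var \<equiv> to_fract [:0, 1:]"

definition rat_matrix :: "(complex^'n^'n) poly \<Rightarrow> ratfun^'n^'n" where
  "rat_matrix F = (\<chi> i j. to_fract (map_poly (\<lambda>A. A $ i $ j) F))"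

definition rm_eval :: "ratfun^'n^'n \<Rightarrow> complex \<Rightarrow> complex^'n^'n" where
  "rm_eval R z = map_matrix (\<lambda>r. rf_eval r z) R"

definition self_adjoint :: "ratfun^'n^'n \<Rightarrow> bool" where
  "self_adjoint R \<longleftrightarrow>
     (\<forall>z. (\<forall>i j. \<not> rf_pole (R $ i $ j) z) \<longrightarrow>
          rm_eval R z = map_matrix cnj (transpose (rm_eval R (cnj z))))"


text \<open>
  The Laurent expansion of \<open>R\<close> for large \<open>\<bar>z\<bar>\<close> is the Laurent expansion of \<open>w \<mapsto> R(1/w)\<close> at \<open>w = 0\<close>;
  \<open>s\<^sub>j\<close> is the coefficient of \<open>z\<^bsup>-(j+1)\<^esup> = w\<^bsup>j+1\<^esup>\<close>.  See lemma \<open>laurent_series_at_infinity\<close>.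
\<close>

definition laurent_coeff :: "ratfun^'n^'n \<Rightarrow> int \<Rightarrow> complex^'n^'n" where
  "laurent_coeff R j =
     map_matrix (\<lambda>r. fls_nth (laurent_expansion (\<lambda>w. rf_eval r (inverse w)) 0) (j + 1)) R"

lemma poly_inverse_has_laurent_expansion:
  "\<exists>G. (\<lambda>w. poly p (inverse w :: complex)) has_laurent_expansion G"
proof (induction p)
  case 0
  show ?case by (auto intro!: exI[of _ 0])
next
  case (pCons a p)
  then obtain G where G: "(\<lambda>w. poly p (inverse w)) has_laurent_expansion G" by blast
  have "(\<lambda>w. a + inverse w * poly p (inverse w)) has_laurent_expansion
          fls_const a + inverse fls_X * G"
    by (intro laurent_expansion_intros G)
  then show ?case by auto
qed

lemma rf_eval_inverse_has_laurent_expansion: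
  "(\<lambda>w. rf_eval r (inverse w)) has_laurent_expansion
     laurent_expansion (\<lambda>w. rf_eval r (inverse w)) 0"
proof -
  obtain G H where
    "(\<lambda>w. poly (fst (quot_of_fract r)) (inverse w)) has_laurent_expansion G"
    "(\<lambda>w. poly (snd (quot_of_fract r)) (inverse w)) has_laurent_expansion H"
    using poly_inverse_has_laurent_expansion by metis
  then have GH: "(\<lambda>w. rf_eval r (inverse w)) has_laurent_expansion G / H"
    unfolding rf_eval_def by (intro laurent_expansion_intros)
  show ?thesis
    using has_laurent_expansion_isolated_0[OF GH] has_laurent_expansion_not_essential_0[OF GH]
    by (intro not_essential_has_laurent_expansion_0)
qed

lemma has_laurent_expansion_sums:
  assumes "f has_laurent_expansion G" and K: "int K \<ge> - fls_subdegree G"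
  shows "eventually (\<lambda>w. (\<lambda>j. fls_nth G (int j + 1) * w ^ (j + 1)) sums
           (f w - (\<Sum>j\<le>K. inverse w ^ j * fls_nth G (- int j)))) (at 0)"
proof -
  define H where "H = fls_base_factor_to_fps G"
  define d where "d = fls_subdegree G"
  define e where "e = nat (int K + d)"
  have e: "int e = int K + d" using K by (simp add: e_def d_def)
  have rad: "0 < fls_conv_radius G" and ev: "eventually (\<lambda>w. eval_fls G w = f w) (at 0)"
    using assms(1) by (auto simp: has_laurent_expansion_def)
  have "eventually (\<lambda>w. w \<in> eball 0 (fls_conv_radius G) - {0}) (at 0)"
    using rad by (intro eventually_at_in_open) (auto simp: zero_ereal_def)
  with ev show ?thesis
  proof eventually_elim
    case (elim w)
    have w: "w \<noteq> 0" "ereal (norm w) < fps_conv_radius H"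
      using elim by (auto simp: H_def fls_conv_radius_altdef)
    have "(\<lambda>n. fps_nth H n * w ^ n) sums eval_fps H w"
      using w by (intro sums_eval_fps) auto
    then have *: "(\<lambda>n. w ^ e * (fps_nth H n * w ^ n)) sums (w ^ e * eval_fps H w)"
      by (rule sums_mult)
    have H: "fps_nth H n = fls_nth G (int n + d)" for n
      by (simp add: H_def d_def)
    have "(\<lambda>n. fls_nth G (int n - int K) * w ^ n) sums (w ^ e * eval_fps H w)"
    proof -
      have "(\<lambda>n. fls_nth G (int (n + e) - int K) * w ^ (n + e)) sums (w ^ e * eval_fps H w)"
        using * by (simp add: H e power_add mult_ac algebra_simps)
      moreover have "(\<Sum>n<e. fls_nth G (int n - int K) * w ^ n) = 0"
        using e by (intro sum.neutral) (auto simp: d_def)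
      ultimately show ?thesis
        using sums_iff_shift[of "\<lambda>n. fls_nth G (int n - int K) * w ^ n" e] by simp
    qed
    then have "(\<lambda>n. fls_nth G (int (n + (K + 1)) - int K) * w ^ (n + (K + 1))) sums
                 (w ^ e * eval_fps H w - (\<Sum>n<K + 1. fls_nth G (int n - int K) * w ^ n))"
      by (rule sums_split_initial_segment)
    then have "(\<lambda>n. inverse w ^ K * (fls_nth G (int n + 1) * w ^ (n + (K + 1)))) sums
                 (inverse w ^ K *
                   (w ^ e * eval_fps H w - (\<Sum>n<K + 1. fls_nth G (int n - int K) * w ^ n)))"
      by (intro sums_mult) (simp add: algebra_simps)
    moreover have "inverse w ^ K * (fls_nth G (int n + 1) * w ^ (n + (K + 1))) =
                     fls_nth G (int n + 1) * w ^ (n + 1)" for n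
      using w by (simp add: power_add field_simps)
    moreover have "inverse w ^ K * (w ^ e * eval_fps H w) = f w"
    proof -
      have "inverse w ^ K * w ^ e = w powi d"
        using w e by (simp add: power_int_add power_int_diff field_simps
            flip: power_int_of_nat)
      then have "inverse w ^ K * (w ^ e * eval_fps H w) = eval_fps H w * w powi d"
        by (metis mult.assoc mult.commute)
      also have "\<dots> = f w"
        using elim(1) by (simp only: eval_fls_def H_def d_def)
      finally show ?thesis .
    qed
    moreover have "inverse w ^ K * (\<Sum>n<K + 1. fls_nth G (int n - int K) * w ^ n) =
                     (\<Sum>j\<le>K. inverse w ^ j * fls_nth G (- int j))"
    proof -
      have "inverse w ^ K * (\<Sum>n<K + 1. fls_nth G (int n - int K) * w ^ n) =
              (\<Sum>n\<le>K. inverse w ^ (K - n) * fls_nth G (- int (K - n)))"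
        unfolding sum_distrib_left
        using w by (intro sum.cong) (auto simp: power_diff field_simps of_nat_diff)
      also have "\<dots> = (\<Sum>j\<le>K. inverse w ^ j * fls_nth G (- int j))"
        by (intro sum.reindex_bij_witness[of _ "\<lambda>j. K - j" "\<lambda>j. K - j"]) auto
      finally show ?thesis .
    qed
    ultimately show ?case
      by (simp only: right_diff_distrib)
  qed
qed

lemma laurent_series_at_infinity:
  fixes R :: "ratfun^'n^'n"
  shows "\<exists>k. eventually (\<lambda>z.
           (\<lambda>j. map_matrix ((*) (inverse z ^ (j + 1))) (laurent_coeff R (int j))) sums
             (rm_eval R z - (\<Sum>j\<le>k. map_matrix ((*) (z ^ j)) (laurent_coeff R (- (int j + 1))))))
           at_infinity"
proof -
  define G where "G = (\<lambda>i j. laurent_expansion (\<lambda>w. rf_eval (R $ i $ j) (inverse w)) 0)"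
  define k where "k = (\<Sum>i\<in>UNIV. \<Sum>j\<in>UNIV. nat (- fls_subdegree (G i j)))"
  have k: "int k \<ge> - fls_subdegree (G i j)" for i j
  proof -
    have "nat (- fls_subdegree (G i j)) \<le> (\<Sum>j\<in>UNIV. nat (- fls_subdegree (G i j)))"
      by (rule member_le_sum) auto
    also have "\<dots> \<le> k"
      unfolding k_def
      by (rule member_le_sum[where f = "\<lambda>i. \<Sum>j\<in>UNIV. nat (- fls_subdegree (G i j))"]) auto
    finally show ?thesis by simp
  qed
  have "\<forall>i j. eventually (\<lambda>w. (\<lambda>n. fls_nth (G i j) (int n + 1) * w ^ (n + 1)) sums
          (rf_eval (R $ i $ j) (inverse w)
            - (\<Sum>n\<le>k. inverse w ^ n * fls_nth (G i j) (- int n)))) (at 0)"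
    using has_laurent_expansion_sums[OF rf_eval_inverse_has_laurent_expansion k[unfolded G_def]]
    unfolding G_def by blast
  then have "eventually (\<lambda>w. \<forall>i j. (\<lambda>n. fls_nth (G i j) (int n + 1) * w ^ (n + 1)) sums
          (rf_eval (R $ i $ j) (inverse w)
            - (\<Sum>n\<le>k. inverse w ^ n * fls_nth (G i j) (- int n)))) (at 0)"
    by (simp add: eventually_all_finite)
  then have "eventually (\<lambda>z. \<forall>i j. (\<lambda>n. fls_nth (G i j) (int n + 1) * inverse z ^ (n + 1)) sums
          (rf_eval (R $ i $ j) z - (\<Sum>n\<le>k. z ^ n * fls_nth (G i j) (- int n)))) at_infinity"
    by (subst (asm) at_to_infinity) (simp add: eventually_filtermap)
  then have "eventually (\<lambda>z.
           (\<lambda>j. map_matrix ((*) (inverse z ^ (j + 1))) (laurent_coeff R (int j))) sums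
             (rm_eval R z - (\<Sum>j\<le>k. map_matrix ((*) (z ^ j)) (laurent_coeff R (- (int j + 1))))))
           at_infinity"
    by (rule eventually_mono)
       (auto simp: sums_def laurent_coeff_def rm_eval_def G_def mult_ac intro!: vec_tendstoI)
  then show ?thesis ..
qed


text \<open>
  Complex matrices with rows and columns indexed by a finite set \<open>I\<close>.  The block Hankel matrix
  \<open>[s\<^sub>a\<^sub>+\<^sub>b]\<close>, \<open>a, b = 0, \<dots>, k\<close>, has the index set \<open>{..k} \<times> UNIV\<close>: the entry at \<open>((a, i), (b, j))\<close> is
  the entry \<open>(i, j)\<close> of the block \<open>(a, b)\<close>.
\<close>

definition negative_definite :: "'i set \<Rightarrow> ('i \<Rightarrow> 'i \<Rightarrow> complex) \<Rightarrow> bool" where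
  "negative_definite I M \<longleftrightarrow>
     (\<forall>i\<in>I. \<forall>j\<in>I. M i j = cnj (M j i)) \<and>
     (\<forall>x. (\<exists>i\<in>I. x i \<noteq> 0) \<longrightarrow> Re (\<Sum>i\<in>I. \<Sum>j\<in>I. cnj (x i) * M i j * x j) < 0)"

definition block_hankel :: "ratfun^'n^'n \<Rightarrow> nat \<times> 'n \<Rightarrow> nat \<times> 'n \<Rightarrow> complex" where
  "block_hankel R = (\<lambda>(a, i) (b, j). laurent_coeff R (int (a + b)) $ i $ j)"

definition hankel_negative_definite :: "nat \<Rightarrow> ratfun^'n^'n \<Rightarrow> bool" where
  "hankel_negative_definite k R \<longleftrightarrow> negative_definite ({..k} \<times> UNIV) (block_hankel R)"


definition R_F :: "(complex^'n^'n) poly \<Rightarrow> ratfun^'n^'n" where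
  "R_F F = - (rat_matrix (odd_part F) ** matrix_inv (rat_matrix (even_part F)))"

definition R_tilde :: "(complex^'n^'n) poly \<Rightarrow> ratfun^'n^'n" where
  "R_tilde F = rat_matrix (even_part F) ** matrix_inv (rat_matrix (odd_part F))"

definition R_tilde_z :: "(complex^'n^'n) poly \<Rightarrow> ratfun^'n^'n" where
  "R_tilde_z F = map_matrix ((*) (- inverse rf_var)) (R_tilde F)"

end

theory Submission
  imports Defs "HOL-Library.Function_Algebras"
begin

text \<open>
  With \<open>F\<^sup>*(z)\<close> the polynomial with conjugate transposed coefficients, self-adjointness of \<open>R\<^sub>F\<close>
  makes \<open>K(z,w) = (F\<^sup>*(z) F(w) - F\<^sup>*(-z) F(-w)) / (z + w)\<close> a polynomial, that is, a Hermitian form on the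
  state space of \<open>F(d/dt) y = 0\<close>.  Along solutions this form has derivative \<open>- |F(-d/dt) y|\<^sup>2\<close>, so by
  Lyapunov's theorem \<open>F\<close> is Hurwitz stable iff the form is positive definite.  It is the direct sum of two
  Bezoutians of \<open>F\<^sub>e, F\<^sub>o\<close>, one for each parity; once the leading coefficient of \<open>F\<^sub>o\<close> is invertible,
  expanding \<open>F\<^sub>e F\<^sub>o\<^sup>-\<^sup>1\<close> at infinity exhibits them as congruent to the two block Hankel matrices and the
  limit.  Both sides of the equivalence force that invertibility.
\<close>

section \<open>Lyapunov's theorem\<close>

text \<open>The derivative along solutions is only semidefinite, of rank at most
  \<open>CARD('n)\<close>, so a strict Lyapunov inequality on all states is out of reach. Strictness
  is asked of eigenvectors only, and zeros on the imaginary axis get an argument of their own. Write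
  \<open>W = F_e F_o^(-1)\<close>, with expansion
  \<open>s_(-2) z + s_(-1) + s_0 z^(-1) + ...\<close>. The even entries of a state see the block
  Hankel matrix \<open>[s_(a+b-1)]\<close> of order \<open>m\<close>; the odd entries see
  \<open>s_(-2)\<close> and, with a minus sign, \<open>[s_(a+b)]\<close> of order
  \<open>m - 1\<close>. Multiplying \<open>W\<close> by \<open>-1/z\<close> moves the index by one
  and flips the sign, which turns the two positivity conditions into negative definiteness for
  \<open>R_tilde_z\<close>. Everything is phrased through coefficients and sesquilinear forms in
  vectors, so that polynomial identities become recursions over indices. An invertible leading
  coefficient of \<open>F_o\<close> serves twice: it makes \<open>W\<close> grow at most linearly,
  and it makes the passage from states to Hankel coordinates triangular with invertible
  diagonal.\<close>

locale complex_operator = vector_space scale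
  for scale :: "complex \<Rightarrow> 'v::ab_group_add \<Rightarrow> 'v" (infixr \<open>*\<^sub>C\<close> 75)
begin

definition poly_apply :: "('v \<Rightarrow> 'v) \<Rightarrow> complex poly \<Rightarrow> 'v \<Rightarrow> 'v" where
  "poly_apply A p x = (\<Sum>k\<le>degree p. coeff p k *\<^sub>C (A ^^ k) x)"

lemma poly_apply_conv_sum:
  assumes "degree p \<le> n"
  shows "poly_apply A p x = (\<Sum>k\<le>n. coeff p k *\<^sub>C (A ^^ k) x)"
  unfolding poly_apply_def using assms
  by (intro sum.mono_neutral_left) (auto simp: coeff_eq_0)

lemma poly_apply_linear_factor:
  assumes "Vector_Spaces.linear (*\<^sub>C) (*\<^sub>C) A"
  shows "poly_apply A ([:-c, 1:] * q) x = A (poly_apply A q x) - c *\<^sub>C poly_apply A q x"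
proof -
  interpret A: Vector_Spaces.linear "(*\<^sub>C)" "(*\<^sub>C)" A by fact
  define n where "n = degree q"
  have "degree ([:-c, 1:] * q) \<le> Suc n"
    unfolding n_def by (rule order_trans[OF degree_mult_le]) simp
  then have "poly_apply A ([:-c, 1:] * q) x
      = (\<Sum>k\<le>Suc n. (coeff (pCons 0 q) k - c * coeff q k) *\<^sub>C (A ^^ k) x)"
    by (subst poly_apply_conv_sum) (auto simp: algebra_simps intro!: sum.cong)
  also have "\<dots> = (\<Sum>k\<le>Suc n. coeff (pCons 0 q) k *\<^sub>C (A ^^ k) x) - c *\<^sub>C (\<Sum>k\<le>Suc n. coeff q k *\<^sub>C (A ^^ k) x)"
    by (simp add: scale_left_diff_distrib sum_subtractf scale_sum_right del: sum.atMost_Suc)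
  also have "(\<Sum>k\<le>Suc n. coeff (pCons 0 q) k *\<^sub>C (A ^^ k) x) = (\<Sum>k\<le>n. coeff q k *\<^sub>C A ((A ^^ k) x))"
    by (subst sum.atMost_Suc_shift) simp
  also have "\<dots> = A (poly_apply A q x)"
    by (simp add: poly_apply_def n_def A.sum A.scale)
  also have "(\<Sum>k\<le>Suc n. coeff q k *\<^sub>C (A ^^ k) x) = poly_apply A q x"
    by (rule poly_apply_conv_sum[symmetric]) (simp add: n_def)
  finally show ?thesis .
qed

text \<open>The \<open>n + 1\<close> vectors from \<open>x\<close> to \<open>(A ^^ n) x\<close> are
  either distinct, hence too many to be independent, or contain a repetition, which gives a
  difference of two monomials. The cases are separate because dependence is a property of sets.
  \<open>bound\<close> expresses that \<open>V\<close> has dimension at most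
  \<open>n\<close>.\<close>

lemma annihilating_poly_exists:
  assumes bound: "\<And>S. S \<subseteq> V \<Longrightarrow> independent S \<Longrightarrow> finite S \<Longrightarrow> card S \<le> n"
    and inv: "\<And>k. (A ^^ k) x \<in> V"
  shows "\<exists>p. p \<noteq> 0 \<and> poly_apply A p x = 0"
proof (cases "inj_on (\<lambda>k. (A ^^ k) x) {..n}")
  case True
  define B where "B = (\<lambda>k. (A ^^ k) x) ` {..n}"
  have "card B = Suc n" "finite B" "B \<subseteq> V"
    using True inv by (auto simp: B_def card_image)
  then have "dependent B" using bound[of B] by auto
  then obtain u w where u: "w \<in> B" "u w \<noteq> 0" "(\<Sum>v\<in>B. u v *\<^sub>C v) = 0"
    using \<open>finite B\<close> by (auto simp: dependent_finite)
  obtain k where k: "k \<le> n" "w = (A ^^ k) x" using u by (auto simp: B_def)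
  define p where "p = (\<Sum>i\<le>n. monom (u ((A ^^ i) x)) i)"
  have c: "coeff p i = (if i \<le> n then u ((A ^^ i) x) else 0)" for i
    by (simp add: p_def coeff_sum)
  have "p \<noteq> 0" using c[of k] k u by auto
  moreover have "poly_apply A p x = (\<Sum>i\<le>n. u ((A ^^ i) x) *\<^sub>C (A ^^ i) x)"
    by (subst poly_apply_conv_sum[of _ n]) (auto simp: c intro!: degree_le)
  then have "poly_apply A p x = 0"
    using u(3) True by (simp add: B_def sum.reindex)
  ultimately show ?thesis by blast
next
  case False
  then obtain i j where ij: "i \<noteq> j" "(A ^^ i) x = (A ^^ j) x" by (auto simp: inj_on_def)
  define p :: "complex poly" where "p = monom 1 i - monom 1 j"
  have "coeff p i = 1" using ij by (simp add: p_def)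
  then have "p \<noteq> 0" by auto
  moreover have "poly_apply A p x = 0"
  proof -
    have c: "coeff p k *\<^sub>C y = (if k = i then y else 0) - (if k = j then y else 0)" for k y
      using ij(1) by (auto simp: p_def)
    have "degree p \<le> max i j" by (auto simp: p_def intro!: degree_le)
    then show ?thesis
      by (subst poly_apply_conv_sum[of _ "max i j"]) (auto simp: c sum_subtractf ij(2))
  qed
  ultimately show ?thesis by blast
qed

text \<open>An annihilator \<open>p\<close> of \<open>x\<close> of least degree has a root
  \<open>c\<close>. With \<open>p = (X - c) q\<close>, minimality makes \<open>q(A) x\<close>
  nonzero, and \<open>A - c\<close> kills it.\<close>

lemma eigenvector_exists:
  assumes A: "Vector_Spaces.linear (*\<^sub>C) (*\<^sub>C) A" and V: "subspace V" and inv: "\<And>x. x \<in> V \<Longrightarrow> A x \<in> V"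
    and bound: "\<And>S. S \<subseteq> V \<Longrightarrow> independent S \<Longrightarrow> finite S \<Longrightarrow> card S \<le> n"
    and x: "x \<in> V" "x \<noteq> 0"
  shows "\<exists>y c. y \<in> V \<and> y \<noteq> 0 \<and> A y = c *\<^sub>C y"
proof -
  have pow: "(A ^^ k) x \<in> V" for k by (induction k) (use x inv in auto)
  obtain p where p: "p \<noteq> 0" "poly_apply A p x = 0"
    and min: "\<And>q. q \<noteq> 0 \<Longrightarrow> poly_apply A q x = 0 \<Longrightarrow> degree p \<le> degree q"
    using annihilating_poly_exists[OF bound pow]
      ex_has_least_nat[of "\<lambda>p. p \<noteq> 0 \<and> poly_apply A p x = 0" _ degree] by blast
  have "degree p \<noteq> 0"
  proof
    assume "degree p = 0"
    then obtain a where "p = [:a:]" by (rule degree_eq_zeroE)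
    then show False using p x by (simp add: poly_apply_def)
  qed
  then obtain c where "poly p c = 0"
    using fundamental_theorem_of_algebra[of p] by (auto simp: constant_degree)
  then obtain q where q: "p = [:-c, 1:] * q" by (auto simp: poly_eq_0_iff_dvd elim: dvdE)
  with p have "q \<noteq> 0" by auto
  then have "degree q < degree p" by (simp only: q) (subst degree_mult_eq, auto)
  then have "poly_apply A q x \<noteq> 0" using min \<open>q \<noteq> 0\<close> by force
  moreover have "A (poly_apply A q x) = c *\<^sub>C poly_apply A q x"
    using p(2) poly_apply_linear_factor[OF A, of c q x] q by simp
  moreover have "poly_apply A q x \<in> V"
    unfolding poly_apply_def using V pow by (intro subspace_sum) (auto simp: subspace_def)
  ultimately show ?thesis by blast
qed

text \<open>
  An eigenvector \<open>v\<close> of \<open>A\<close> satisfies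
  \<open>2 Re c \<cdot> K v v = - Q v v < 0\<close>, hence \<open>K v v > 0\<close>, and the hypotheses pass to the
  compression of \<open>A\<close> to the \<open>K\<close>-orthogonal complement of \<open>v\<close>.
\<close>
lemma lyapunov_positive:
  fixes K Q :: "'v \<Rightarrow> 'v \<Rightarrow> complex"
  assumes K: "\<And>x y z. K x (y + z) = K x y + K x z" "\<And>x y c. K x (c *\<^sub>C y) = c * K x y"
      "\<And>x y. K y x = cnj (K x y)"
    and Q: "\<And>x. Im (Q x x) = 0" "\<And>x. Re (Q x x) \<ge> 0" "\<And>x y. Q x x = 0 \<Longrightarrow> Q x y = 0"
    and A: "Vector_Spaces.linear (*\<^sub>C) (*\<^sub>C) A"
    and V: "subspace V" and inv: "\<And>x. x \<in> V \<Longrightarrow> A x \<in> V"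
    and bound: "\<And>S. S \<subseteq> V \<Longrightarrow> independent S \<Longrightarrow> finite S \<Longrightarrow> card S \<le> n"
    and eigen: "\<And>x c. x \<in> V \<Longrightarrow> x \<noteq> 0 \<Longrightarrow> A x = c *\<^sub>C x \<Longrightarrow> Re c < 0 \<and> Q x x \<noteq> 0"
    and lyap: "\<And>x y. x \<in> V \<Longrightarrow> y \<in> V \<Longrightarrow> K (A x) y + K x (A y) = - Q x y"
    and x: "x \<in> V" "x \<noteq> 0"
  shows "Re (K x x) > 0"
  using A V inv bound eigen lyap x
proof (induction n arbitrary: A V x)
  case 0
  have "independent {x}" using \<open>x \<noteq> 0\<close> by simp
  then show ?case using "0.prems"(4)[of "{x}"] \<open>x \<in> V\<close> by simp
next
  case (Suc n)
  note A = Suc.prems(1) and V = Suc.prems(2) and inv = Suc.prems(3) and bound = Suc.prems(4)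
    and eigen = Suc.prems(5) and lyap = Suc.prems(6) and x = Suc.prems(7,8)
  interpret A: Vector_Spaces.linear "(*\<^sub>C)" "(*\<^sub>C)" A by fact
  have K': "K (y + z) x = K y x + K z x" "K (c *\<^sub>C y) x = cnj c * K y x" for x y z c
    by (metis K(1,3) complex_cnj_add) (metis K(2,3) complex_cnj_mult)
  have K_diff: "K x (y - z) = K x y - K x z" for x y z
    using K(1)[of x "y - z" z] by simp
  have K'_diff: "K (y - z) x = K y x - K z x" for x y z
    using K'(1)[of "y - z" z x] by simp
  obtain v c where v: "v \<in> V" "v \<noteq> 0" "A v = c *\<^sub>C v"
    using eigenvector_exists[OF A V inv bound x] by blast
  have Imv: "Im (K v v) = 0" using arg_cong[OF K(3)[of v v], of Im] by simp
  have Kv: "Re (K v v) > 0"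
  proof -
    have "cnj c * K v v + c * K v v = - Q v v"
      using lyap[OF v(1,1)] v(3) by (simp add: K(1,2) K')
    then have "Re (cnj c * K v v + c * K v v) = - Re (Q v v)" by simp
    then have "2 * Re c * Re (K v v) = - Re (Q v v)" by (simp add: Imv)
    moreover have "Re (Q v v) > 0"
      using eigen[OF v] Q(1,2)[of v] by (auto simp: complex_eq_iff less_le)
    ultimately have "Re c * Re (K v v) < 0" by linarith
    moreover have "Re c < 0" using eigen[OF v] by simp
    ultimately show ?thesis by (simp add: mult_less_0_iff)
  qed
  then have Kv0: "K v v \<noteq> 0" by auto
  define P where "P = (\<lambda>y. y - (K v y / K v v) *\<^sub>C v)"
  define V' where "V' = {y \<in> V. K v y = 0}"
  define A' where "A' = (\<lambda>y. P (A y))"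
  have KP: "K v (P y) = 0" for y using Kv0 by (simp add: P_def K_diff K(1,2))
  have PV: "P y \<in> V'" if "y \<in> V" for y
    using that v(1) V KP by (auto simp: V'_def P_def subspace_diff subspace_scale)
  have V': "subspace V'"
    using V K(1,2)[of v] K(2)[of v 0] by (auto simp: V'_def subspace_def)
  have A': "Vector_Spaces.linear (*\<^sub>C) (*\<^sub>C) A'"
    by unfold_locales
       (auto simp: A'_def P_def A.add A.scale K(1,2) scale_right_diff_distrib add_divide_distrib
         scale_left_distrib algebra_simps)
  \<comment> \<open>The dimension drops because \<open>v\<close> lies in \<open>V\<close> but not in
    \<open>V'\<close>, so it can be adjoined to any independent subset of \<open>V'\<close>.\<close>
  have bound': "card S \<le> n" if S: "S \<subseteq> V'" "independent S" "finite S" for S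
  proof -
    have "v \<notin> V'" using Kv0 by (auto simp: V'_def)
    then have "v \<notin> span S" using span_minimal[OF S(1) V'] by auto
    then have "independent (insert v S)" "v \<notin> S"
      using S(2) by (auto simp: independent_insert span_base)
    moreover have "insert v S \<subseteq> V" using S(1) v(1) by (auto simp: V'_def)
    ultimately show ?thesis using bound[of "insert v S"] S(3) by simp
  qed
  have lyap': "K (A' y) z + K y (A' z) = - Q y z" if "y \<in> V'" "z \<in> V'" for y z
  proof -
    have "K v z = 0" "K y v = 0" using that K(3)[of v y] by (auto simp: V'_def)
    then have "K (A' y) z + K y (A' z) = K (A y) z + K y (A z)"
      by (simp add: A'_def P_def K_diff K'_diff K(1,2) K')
    with lyap that show ?thesis by (simp add: V'_def)
  qed
  \<comment> \<open>An eigenvector \<open>y\<close> of the compression satisfies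
    \<open>A y = d y + a v\<close>, so \<open>A\<close> is triangular on the span of
    \<open>v\<close> and \<open>y\<close>. If \<open>d = c\<close>, the bound on \<open>Re c\<close>
    applies; otherwise \<open>y + b v\<close> with \<open>b = a / (d - c)\<close> is an eigenvector
    of \<open>A\<close> itself for \<open>d\<close>.\<close>
  have eigen': "Re d < 0 \<and> Q y y \<noteq> 0" if y: "y \<in> V'" "y \<noteq> 0" "A' y = d *\<^sub>C y" for y d
  proof -
    define a where "a = K v (A y) / K v v"
    have Ay: "A y = d *\<^sub>C y + a *\<^sub>C v" using y(3) by (simp add: A'_def P_def a_def algebra_simps)
    have yV: "y \<in> V" and Kvy: "K v y = 0" using y by (auto simp: V'_def)
    have "Re d < 0"
    proof (cases "d = c")
      case True then show ?thesis using eigen[OF v] by simp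
    next
      case False
      define b where "b = a / (d - c)"
      define z where "z = y + b *\<^sub>C v"
      have b: "a + b * c = d * b" using False by (simp add: b_def field_simps)
      have "A z = d *\<^sub>C y + (a + b * c) *\<^sub>C v"
        by (simp add: z_def A.add A.scale Ay v(3) algebra_simps)
      also have "\<dots> = d *\<^sub>C z" unfolding b by (simp add: z_def algebra_simps)
      finally have "A z = d *\<^sub>C z" .
      moreover have "z \<in> V" using yV v(1) V by (simp add: z_def subspace_add subspace_scale)
      moreover have "z \<noteq> 0"
      proof
        assume "z = 0"
        then have "K v z = K v (0 *\<^sub>C v)" by simp
        then have "b * K v v = 0" using Kvy by (simp only: z_def K(1,2)) simp
        then have "b = 0" using Kv0 by simp
        then show False using \<open>z = 0\<close> y(2) by (simp add: z_def)
      qed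
      ultimately show ?thesis using eigen by blast
    qed
    \<comment> \<open>If \<open>Q y y\<close> vanished, so would \<open>Q y v\<close>, and the
      Lyapunov identity for \<open>y\<close> and \<open>v\<close> would reduce to
      \<open>cnj a * K v v = 0\<close>. Then \<open>a = 0\<close>, and \<open>y\<close> would be an
      eigenvector of \<open>A\<close> on which \<open>Q\<close> vanishes.\<close>
    moreover have "Q y y \<noteq> 0"
    proof
      assume "Q y y = 0"
      then have "K (A y) v + K y (A v) = 0" using lyap[OF yV v(1)] Q(3) by simp
      moreover have "K y v = 0" using Kvy K(3)[of v y] by simp
      ultimately have "a = 0" using Kv0 by (simp add: Ay v(3) K(1,2) K')
      then have "A y = d *\<^sub>C y" using Ay by simp
      then show False using eigen[OF yV y(2)] \<open>Q y y = 0\<close> by blast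
    qed
    ultimately show ?thesis ..
  qed
  have pos': "Re (K y y) > 0" if "y \<in> V'" "y \<noteq> 0" for y
  proof (rule Suc.IH[OF A' V' _ bound' eigen' lyap' that])
    show "A' z \<in> V'" if "z \<in> V'" for z
      using that inv PV by (auto simp: A'_def V'_def)
  qed
  define b where "b = K v x / K v v"
  have xP: "x = P x + b *\<^sub>C v" by (simp add: P_def b_def)
  have *: "K (P x) v = 0" using KP[of x] K(3)[of v "P x"] by simp
  have "K x x = K (P x + b *\<^sub>C v) (P x + b *\<^sub>C v)" using xP by simp
  also have "\<dots> = K (P x) (P x) + (cnj b * b) * K v v"
    by (simp add: K(1,2) K' KP *)
  finally have eq: "Re (K x x) = Re (K (P x) (P x)) + (cmod b)\<^sup>2 * Re (K v v)"
    using cmod_power2[of b] by (simp add: Imv power2_eq_square)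
  show ?case
  proof (cases "P x = 0")
    case True
    then have "b \<noteq> 0" using xP x(2) by auto
    moreover have "K (P x) (P x) = 0" using True K(2)[of 0 0 0] by simp
    ultimately show ?thesis using eq Kv by simp
  next
    case False
    then have "Re (K (P x) (P x)) > 0" using pos' PV x(1) by blast
    moreover have "(cmod b)\<^sup>2 * Re (K v v) \<ge> 0" using Kv by simp
    ultimately show ?thesis using eq by linarith
  qed
qed

end

section \<open>The Hermite--Fujiwara form\<close>

definition herm_inner :: "complex^'n \<Rightarrow> complex^'n \<Rightarrow> complex" where
  "herm_inner u v = (\<Sum>i\<in>UNIV. cnj (u $ i) * v $ i)"

lemma herm_inner_add: "herm_inner u (v + w) = herm_inner u v + herm_inner u w" "herm_inner (u + v) w = herm_inner u w + herm_inner v w"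
  by (simp_all add: herm_inner_def algebra_simps sum.distrib)

lemma herm_inner_minus: "herm_inner u (- v) = - herm_inner u v" "herm_inner (- u) v = - herm_inner u v"
  by (simp_all add: herm_inner_def sum_negf)

lemma herm_inner_scale: "herm_inner u (c *s v) = c * herm_inner u v" "herm_inner (c *s u) v = cnj c * herm_inner u v"
  by (simp_all add: herm_inner_def sum_distrib_left mult_ac)

lemma herm_inner_zero [simp]: "herm_inner u 0 = 0" "herm_inner 0 u = 0"
  by (simp_all add: herm_inner_def)

lemma herm_inner_commute: "herm_inner v u = cnj (herm_inner u v)"
  by (simp add: herm_inner_def mult.commute)

lemma herm_inner_sum: "herm_inner u (\<Sum>i\<in>A. g i) = (\<Sum>i\<in>A. herm_inner u (g i))"
    "herm_inner (\<Sum>i\<in>A. g i) u = (\<Sum>i\<in>A. herm_inner (g i) u)"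
  by (induction A rule: infinite_finite_induct; simp add: herm_inner_add)+

lemma herm_inner_self: "herm_inner u u = of_real (\<Sum>i\<in>UNIV. (cmod (u $ i))\<^sup>2)"
  by (simp add: herm_inner_def complex_norm_square[unfolded of_real_power] mult.commute)

lemma herm_inner_self_Re: "Re (herm_inner u u) \<ge> 0" and herm_inner_self_Im [simp]: "Im (herm_inner u u) = 0"
  by (simp_all add: herm_inner_self sum_nonneg)

lemma herm_inner_self_eq_0 [simp]: "herm_inner u u = 0 \<longleftrightarrow> u = 0"
proof
  assume "herm_inner u u = 0"
  then have "(\<Sum>i\<in>UNIV. (cmod (u $ i))\<^sup>2) = 0" by (metis herm_inner_self of_real_eq_0_iff)
  then show "u = 0" by (simp add: sum_nonneg_eq_0_iff vec_eq_iff)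
qed simp

lemma matrix_vector_mult_sum: "M *v (\<Sum>i\<in>A. g i) = (\<Sum>i\<in>A. M *v g i)"
  for M :: "complex^'n^'m"
  by (induction A rule: infinite_finite_induct) (simp_all add: matrix_vector_right_distrib)

section \<open>Vector sequences and the finite-dimensional state space inside them\<close>

interpretation seq: complex_operator "\<lambda>(c::complex) (x::nat \<Rightarrow> complex^'n) k. c *s x k"
  by unfold_locales
     (auto simp: fun_eq_iff vector_add_ldistrib vector_sadd_rdistrib vector_smult_assoc)

definition unit_seq :: "nat \<Rightarrow> 'n \<Rightarrow> nat \<Rightarrow> complex^'n" where
  "unit_seq k i = (\<lambda>j. if j = k then axis i 1 else 0)"

lemma sum_fun_apply: "(\<Sum>i\<in>A. g i) k = (\<Sum>i\<in>A. g i k)"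
  for g :: "'i \<Rightarrow> nat \<Rightarrow> complex^'n"
  by (induction A rule: infinite_finite_induct) simp_all

lemma bounded_seq_in_span:
  fixes x :: "nat \<Rightarrow> complex^'n"
  assumes "\<And>k. k \<ge> N \<Longrightarrow> x k = 0"
  shows "x \<in> seq.span (case_prod unit_seq ` ({..<N} \<times> UNIV))"
proof -
  have "x = (\<Sum>(k, i)\<in>{..<N} \<times> UNIV. (\<lambda>j. x k $ i *s unit_seq k i j))"
  proof
    fix j
    have "(\<Sum>(k, i)\<in>{..<N} \<times> UNIV. (\<lambda>j. x k $ i *s unit_seq k i j)) j
        = (\<Sum>k<N. \<Sum>i\<in>UNIV. if k = j then x k $ i *s axis i 1 else 0)"
      by (simp add: sum_fun_apply case_prod_unfold sum.cartesian_product unit_seq_def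
          if_distrib[of "\<lambda>v. _ *s v"] cong: if_cong)
         (auto intro!: sum.cong)
    also have "\<dots> = (\<Sum>k<N. if k = j then x k else 0)"
      by (intro sum.cong) (auto simp: basis_expansion)
    also have "\<dots> = x j" using assms by auto
    finally show "x j = (\<Sum>(k, i)\<in>{..<N} \<times> UNIV. (\<lambda>j. x k $ i *s unit_seq k i j)) j" ..
  qed
  moreover have "(\<Sum>(k, i)\<in>{..<N} \<times> UNIV. (\<lambda>j. x k $ i *s unit_seq k i j))
      \<in> seq.span (case_prod unit_seq ` ({..<N} \<times> UNIV))"
    by (intro seq.span_sum) (clarify, rule seq.span_scale, rule seq.span_base, force)
  ultimately show ?thesis by simp
qed

text \<open>The sum in \<open>alternating\<close> is the coefficient of \<open>z^c\<close> in
  \<open>F^*(-z) F(z)\<close>, so the assumption says that this product is an even polynomial.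
  Equivalently \<open>F_e^* F_o = F_o^* F_e\<close>, the form in which self-adjointness of
  \<open>R_F\<close> enters.\<close>

locale hermite_fujiwara =
  fixes f :: "nat \<Rightarrow> complex^'n^'n" and N :: nat
  assumes N: "N > 0" and monic: "f N = mat 1" and high: "\<And>k. k > N \<Longrightarrow> f k = 0"
    and alternating: "\<And>c u v. odd c \<Longrightarrow> (\<Sum>i\<le>c. (-1) ^ i * herm_inner (f i *v u) (f (c - i) *v v)) = 0"
begin

text \<open>The coefficient of \<open>z^a w^b\<close> in \<open>F^*(z) F(w) - F^*(-z) F(-w)\<close>:
  only odd total degrees survive, and they are doubled.\<close>

definition num_coeff :: "nat \<Rightarrow> nat \<Rightarrow> complex^'n \<Rightarrow> complex^'n \<Rightarrow> complex" where
  "num_coeff a b u v = (1 - (-1) ^ (a + b)) * herm_inner (f a *v u) (f b *v v)"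

text \<open>
  \<open>kernel_coeff a b\<close> is the coefficient of \<open>z\<^bsup>a\<^esup> w\<^bsup>b\<^esup>\<close> in
  \<open>(F\<^sup>*(z) F(w) - F\<^sup>*(-z) F(-w)) / (z + w)\<close>, where \<open>F\<^sup>*\<close> has the coefficients \<open>(f k)\<^sup>*\<close>;
  the division is exact by the locale assumption \<open>alternating\<close>.
\<close>
definition kernel_coeff :: "nat \<Rightarrow> nat \<Rightarrow> complex^'n \<Rightarrow> complex^'n \<Rightarrow> complex" where
  "kernel_coeff a b u v = (\<Sum>i\<le>b. (-1) ^ i * num_coeff (a + 1 + i) (b - i) u v)"

definition kernel_form :: "(nat \<Rightarrow> complex^'n) \<Rightarrow> (nat \<Rightarrow> complex^'n) \<Rightarrow> complex" where
  "kernel_form x y = (\<Sum>a<N. \<Sum>b<N. kernel_coeff a b (x a) (y b))"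

lemma num_coeff_commute: "num_coeff b a v u = cnj (num_coeff a b u v)"
  by (simp add: num_coeff_def herm_inner_commute[of "f b *v v"] add.commute)

lemma kernel_coeff_0: "kernel_coeff a 0 u v = num_coeff (Suc a) 0 u v"
  by (simp add: kernel_coeff_def)

text \<open>Comparison of the coefficients of \<open>z^(a+1) w^(b+1)\<close> after multiplying the
  kernel by \<open>z + w\<close>.\<close>

lemma kernel_coeff_Suc: "kernel_coeff a (Suc b) u v = num_coeff (Suc a) (Suc b) u v - kernel_coeff (Suc a) b u v"
  unfolding kernel_coeff_def by (subst sum.atMost_Suc_shift) (simp add: sum_negf)

text \<open>This is where exactness of the division is used. The recursion already fixes the kernel
  from the terms without \<open>w\<close>; agreement on the terms without \<open>z\<close> amounts
  to the numerator vanishing at \<open>w = -z\<close>. In odd degree that is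
  \<open>alternating\<close>, in even degree all terms are zero.\<close>

lemma kernel_coeff_0_left: "kernel_coeff 0 b u v = num_coeff 0 (Suc b) u v"
proof -
  have "(\<Sum>i\<le>Suc b. (-1) ^ i * num_coeff i (Suc b - i) u v) = 0"
  proof (cases "even b")
    case True
    then have "(\<Sum>i\<le>Suc b. (-1) ^ i * num_coeff i (Suc b - i) u v)
        = 2 * (\<Sum>i\<le>Suc b. (-1) ^ i * herm_inner (f i *v u) (f (Suc b - i) *v v))"
      unfolding sum_distrib_left num_coeff_def by (intro sum.cong) auto
    with True show ?thesis using alternating[of "Suc b" u v] by simp
  next
    case False
    then show ?thesis by (intro sum.neutral) (auto simp: num_coeff_def)
  qed
  then show ?thesis
    by (subst (asm) sum.atMost_Suc_shift) (simp add: kernel_coeff_def sum_negf)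
qed

text \<open>The numerator is Hermitian and the recursion is symmetric, while exchanging the
  variables exchanges the two boundary formulas, one of which starts the induction.\<close>

lemma kernel_coeff_commute: "kernel_coeff b a v u = cnj (kernel_coeff a b u v)"
proof (induction b arbitrary: a)
  case 0
  show ?case by (simp add: kernel_coeff_0 kernel_coeff_0_left num_coeff_commute[of 0])
next
  case (Suc b)
  have "kernel_coeff (Suc b) a v u = num_coeff (Suc b) (Suc a) v u - kernel_coeff b (Suc a) v u"
    using kernel_coeff_Suc[of b a v u] by simp
  then show ?case by (simp add: kernel_coeff_Suc[of a] Suc.IH num_coeff_commute[of "Suc b" "Suc a"])
qed

text \<open>The bound in \<open>a\<close> is visible from the degree of \<open>F\<close>; the bound
  in \<open>b\<close> is not visible in the defining sum and comes from Hermitian symmetry.\<close>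

lemma kernel_coeff_high: "a \<ge> N \<Longrightarrow> kernel_coeff a b u v = 0" "b \<ge> N \<Longrightarrow> kernel_coeff a b u v = 0"
proof -
  show *: "a \<ge> N \<Longrightarrow> kernel_coeff a b u v = 0" for a b u v
    unfolding kernel_coeff_def num_coeff_def by (intro sum.neutral) (auto simp: high)
  show "b \<ge> N \<Longrightarrow> kernel_coeff a b u v = 0"
    using *[of b a v u] by (simp add: kernel_coeff_commute[of a b u v])
qed

lemma kernel_coeff_right: "kernel_coeff a b u (v + w) = kernel_coeff a b u v + kernel_coeff a b u w" "kernel_coeff a b u (c *s v) = c * kernel_coeff a b u v"
  by (simp_all add: kernel_coeff_def num_coeff_def matrix_vector_right_distrib vector_scalar_commute herm_inner_add herm_inner_scale
      sum.distrib sum_distrib_left algebra_simps)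

lemma kernel_coeff_left: "kernel_coeff a b (u + w) v = kernel_coeff a b u v + kernel_coeff a b w v" "kernel_coeff a b (c *s u) v = cnj c * kernel_coeff a b u v"
  by (simp_all add: kernel_coeff_def num_coeff_def matrix_vector_right_distrib vector_scalar_commute herm_inner_add herm_inner_scale
      sum.distrib sum_distrib_left algebra_simps)

lemma kernel_coeff_zero [simp]: "kernel_coeff a b 0 v = 0" "kernel_coeff a b u 0 = 0"
  by (simp_all add: kernel_coeff_def num_coeff_def)

lemma kernel_form_right: "kernel_form x (y + z) = kernel_form x y + kernel_form x z" "kernel_form x (\<lambda>k. c *s y k) = c * kernel_form x y"
  by (simp_all add: kernel_form_def kernel_coeff_right sum.distrib sum_distrib_left)

lemma kernel_form_left: "kernel_form (y + z) x = kernel_form y x + kernel_form z x" "kernel_form (\<lambda>k. c *s y k) x = cnj c * kernel_form y x"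
  by (simp_all add: kernel_form_def kernel_coeff_left sum.distrib sum_distrib_left)

lemma kernel_form_commute: "kernel_form y x = cnj (kernel_form x y)"
  unfolding kernel_form_def by (subst sum.swap) (simp add: kernel_coeff_commute[of _ _ "y _"])

lemma kernel_form_cong: "(\<And>k. k < N \<Longrightarrow> x k = x' k) \<Longrightarrow> (\<And>k. k < N \<Longrightarrow> y k = y' k) \<Longrightarrow> kernel_form x y = kernel_form x' y'"
  by (simp add: kernel_form_def)

text \<open>With \<open>S\<close> the shift, \<open>seq_apply 1 x\<close> and
  \<open>seq_apply (-1) x\<close> are the entries at 0 of \<open>F(S) x\<close> and
  \<open>F(-S) x\<close>. On a constant sequence, \<open>seq_apply z (\<lambda>_. v)\<close> is
  \<open>F(z) v\<close>.\<close>

definition seq_apply :: "complex \<Rightarrow> (nat \<Rightarrow> complex^'n) \<Rightarrow> complex^'n" where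
  "seq_apply s x = (\<Sum>k\<le>N. s ^ k *s (f k *v x k))"

text \<open>The identity \<open>(z + w) K(z,w) = F^*(z) F(w) - F^*(-z) F(-w)\<close> with
  \<open>z^a\<close> paired with \<open>x a\<close> and \<open>w^b\<close> with \<open>y b\<close>,
  so that multiplication by a variable becomes a shift. It holds for arbitrary sequences, and its
  left side also reads the entries at \<open>N\<close>.\<close>

lemma kernel_form_shift:
  "kernel_form (\<lambda>k. x (Suc k)) y + kernel_form x (\<lambda>k. y (Suc k)) = herm_inner (seq_apply 1 x) (seq_apply 1 y) - herm_inner (seq_apply (-1) x) (seq_apply (-1) y)"
proof -
  \<comment> \<open>\<open>L\<close> and \<open>R\<close> collect the coefficients of
    \<open>z K\<close> and \<open>w K\<close>.\<close>
  define L where "L = (\<lambda>a b. case a of 0 \<Rightarrow> 0 | Suc a' \<Rightarrow> kernel_coeff a' b (x a) (y b))"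
  define R where "R = (\<lambda>a b. case b of 0 \<Rightarrow> 0 | Suc b' \<Rightarrow> kernel_coeff a b' (x a) (y b))"
  have first: "(\<Sum>b\<le>N. h b) = h 0 + (\<Sum>b<N. h (Suc b))"
    and last: "(\<Sum>b\<le>N. h b) = (\<Sum>b<N. h b) + h N" for h :: "nat \<Rightarrow> complex"
    using sum.lessThan_Suc_shift[of h N] sum.lessThan_Suc[of h N] by (simp_all add: lessThan_Suc_atMost)
  have LR: "num_coeff a b (x a) (y b) = L a b + R a b" for a b
    by (cases a; cases b) (simp_all add: L_def R_def kernel_coeff_0 kernel_coeff_0_left kernel_coeff_Suc, simp add: num_coeff_def)
  have "herm_inner (seq_apply 1 x) (seq_apply 1 y) - herm_inner (seq_apply (-1) x) (seq_apply (-1) y) = (\<Sum>a\<le>N. \<Sum>b\<le>N. num_coeff a b (x a) (y b))"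
    unfolding seq_apply_def herm_inner_sum sum_subtractf[symmetric] num_coeff_def
    by (subst sum.swap)
       (auto simp: herm_inner_scale power_add algebra_simps sum_subtractf)
  also have "\<dots> = (\<Sum>a\<le>N. \<Sum>b\<le>N. L a b) + (\<Sum>a\<le>N. \<Sum>b\<le>N. R a b)"
    by (simp add: LR sum.distrib)
  also have "(\<Sum>a\<le>N. \<Sum>b\<le>N. L a b) = kernel_form (\<lambda>k. x (Suc k)) y"
    by (subst first) (simp add: L_def kernel_form_def, simp add: last kernel_coeff_high)
  also have "(\<Sum>a\<le>N. \<Sum>b\<le>N. R a b) = kernel_form x (\<lambda>k. y (Suc k))"
    unfolding first[of "R _"] by (simp add: R_def kernel_form_def, simp add: last kernel_coeff_high)
  finally show ?thesis by simp
qed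

text \<open>As the leading coefficient is the identity, the entry at \<open>N\<close> is the one
  that makes \<open>seq_apply 1\<close> vanish. This removes the first term on the right of
  \<open>kernel_form_shift\<close>.\<close>

definition monic_ext :: "(nat \<Rightarrow> complex^'n) \<Rightarrow> nat \<Rightarrow> complex^'n" where
  "monic_ext x k = (if k < N then x k else if k = N then - (\<Sum>j<N. f j *v x j) else 0)"

text \<open>The eigenvectors are \<open>k \<mapsto> c ^ k *s v\<close> with \<open>F(c) v = 0\<close>, cut off at \<open>N\<close>.\<close>
definition companion :: "(nat \<Rightarrow> complex^'n) \<Rightarrow> nat \<Rightarrow> complex^'n" where
  "companion x k = monic_ext x (Suc k)"

lemma monic_ext_linear: "monic_ext (x + y) k = monic_ext x k + monic_ext y k" "monic_ext (\<lambda>k. c *s x k) k = c *s monic_ext x k"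
  by (auto simp: monic_ext_def matrix_vector_right_distrib sum.distrib vector_scalar_commute
      vec.scale_sum_right)

lemma seq_apply_monic_ext: "seq_apply 1 (monic_ext x) = 0"
  by (simp add: seq_apply_def monic_ext_def lessThan_Suc_atMost[symmetric] monic)

definition positive :: bool where
  "positive \<longleftrightarrow> (\<forall>x. (\<forall>k\<ge>N. x k = 0) \<longrightarrow> x \<noteq> 0 \<longrightarrow> Re (kernel_form x x) > 0)"

text \<open>Lyapunov's theorem applied to the companion operator. The hypothesis on zeros of
  \<open>F\<close> is used twice, for an eigenvalue \<open>c\<close> and for
  \<open>-c\<close>.\<close>

lemma positive_if_stable:
  assumes stable: "\<And>z v. v \<noteq> 0 \<Longrightarrow> seq_apply z (\<lambda>_. v) = 0 \<Longrightarrow> Re z < 0"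
  shows positive
  unfolding positive_def
proof (intro allI impI)
  fix x0 :: "nat \<Rightarrow> complex^'n"
  assume x0: "\<forall>k\<ge>N. x0 k = 0" "x0 \<noteq> 0"
  define V where "V = {x :: nat \<Rightarrow> complex^'n. \<forall>k\<ge>N. x k = 0}"
  define T where "T = case_prod unit_seq ` ({..<N} \<times> (UNIV :: 'n set))"
  show "Re (kernel_form x0 x0) > 0"
  proof (rule seq.lyapunov_positive[where K = kernel_form and Q = "\<lambda>x y. herm_inner (seq_apply (-1) (monic_ext x)) (seq_apply (-1) (monic_ext y))"
        and V = V and A = companion and n = "card T"])
    show "Vector_Spaces.linear (\<lambda>c x k. c *s x k) (\<lambda>c x k. c *s x k) companion"
      by unfold_locales (auto simp: companion_def monic_ext_linear fun_eq_iff)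
    show "seq.subspace V" by (auto simp: V_def seq.subspace_def)
    show "companion x \<in> V" for x by (auto simp: V_def companion_def monic_ext_def)
    show "card S \<le> card T" if "S \<subseteq> V" "seq.independent S" for S
    proof -
      have "finite T" "S \<subseteq> seq.span T"
        using that(1) by (auto simp: V_def T_def intro!: bounded_seq_in_span)
      then show ?thesis using seq.independent_span_bound that(2) by blast
    qed
    show "Re c < 0 \<and> herm_inner (seq_apply (-1) (monic_ext x)) (seq_apply (-1) (monic_ext x)) \<noteq> 0"
      if x: "x \<in> V" "x \<noteq> 0" "companion x = (\<lambda>k. c *s x k)" for x c
    proof -
      have "monic_ext x k = c ^ k *s x 0" if "k \<le> N" for k
        using that
      proof (induction k)
        case 0
        then show ?case using N by (simp add: monic_ext_def)
      next
        case (Suc k)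
        have "monic_ext x (Suc k) = c *s x k" using fun_cong[OF x(3), of k] by (simp add: companion_def)
        then show ?case using Suc by (simp add: monic_ext_def vector_smult_assoc)
      qed
      then have FFx: "seq_apply s (monic_ext x) = seq_apply (s * c) (\<lambda>_. x 0)" for s
        by (simp add: seq_apply_def vector_scalar_commute vector_smult_assoc power_mult_distrib)
      have "x 0 \<noteq> 0"
      proof
        assume "x 0 = 0"
        then have "x k = 0" for k
          using \<open>\<And>k. k \<le> N \<Longrightarrow> monic_ext x k = c ^ k *s x 0\<close>[of k] x(1) by (cases "k < N") (auto simp: monic_ext_def V_def)
        then show False using x(2) by auto
      qed
      moreover have "seq_apply c (\<lambda>_. x 0) = 0" using FFx[of 1] seq_apply_monic_ext by simp
      ultimately have "Re c < 0" using stable by blast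
      moreover have "seq_apply (-c) (\<lambda>_. x 0) \<noteq> 0" using stable[OF \<open>x 0 \<noteq> 0\<close>, of "-c"] \<open>Re c < 0\<close> by auto
      ultimately show ?thesis using FFx[of "-1"] by simp
    qed
    show "kernel_form (companion x) y + kernel_form x (companion y) = - herm_inner (seq_apply (-1) (monic_ext x)) (seq_apply (-1) (monic_ext y))" for x y
    proof -
      \<comment> \<open>The form reads entries below \<open>N\<close> only, and there a state agrees
        with its extension.\<close>
      have "kernel_form (companion x) y = kernel_form (\<lambda>k. monic_ext x (Suc k)) (monic_ext y)"
           "kernel_form x (companion y) = kernel_form (monic_ext x) (\<lambda>k. monic_ext y (Suc k))"
        by (auto intro!: kernel_form_cong simp: companion_def monic_ext_def)
      then show ?thesis using kernel_form_shift[of "monic_ext x" "monic_ext y"] by (simp add: seq_apply_monic_ext)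
    qed
    show "x0 \<in> V" using x0 by (simp add: V_def)
    show "kernel_form y x = cnj (kernel_form x y)" for x y by (rule kernel_form_commute)
  qed (simp_all add: kernel_form_right herm_inner_self_Re x0(2))
qed

text \<open>On \<open>x k = z^k v\<close> the shift acts as multiplication by \<open>z\<close>, so
  the identity becomes \<open>2 Re z K(x,x) = - |F(-z) v|^2\<close> and gives
  \<open>Re z \<le> 0\<close>. The imaginary axis is excluded by showing that \<open>x\<close> would
  lie in the radical of \<open>K\<close>.\<close>

lemma stable_if_positive:
  assumes pos: positive and v: "v \<noteq> 0" "seq_apply z (\<lambda>_. v) = 0"
  shows "Re z < 0"
proof -
  define x where "x = (\<lambda>k. z ^ k *s v)"
  define x' where "x' = (\<lambda>k. if k < N then x k else 0)"
  have xx: "kernel_form x' y = kernel_form x y" "kernel_form y x' = kernel_form y x" for y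
    by (auto intro!: kernel_form_cong simp: x'_def)
  have "x' 0 \<noteq> 0" using v(1) N by (simp add: x'_def x_def)
  then have "x' \<noteq> 0" by auto
  moreover have "\<forall>k\<ge>N. x' k = 0" by (simp add: x'_def)
  ultimately have "Re (kernel_form x' x') > 0" using pos by (simp add: positive_def)
  then have Kx: "Re (kernel_form x x) > 0" by (simp add: xx)
  have Imx: "Im (kernel_form x x) = 0" using arg_cong[OF kernel_form_commute[of x x], of Im] by simp
  have Sx: "(\<lambda>k. x (Suc k)) = (\<lambda>k. z *s x k)" by (simp add: x_def vector_smult_assoc)
  have F: "seq_apply 1 x = 0" "seq_apply (-1) x = seq_apply (-z) (\<lambda>_. v)"
    using v(2) by (simp_all add: x_def seq_apply_def vector_scalar_commute vector_smult_assoc flip: power_mult_distrib)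
  have shift: "kernel_form (\<lambda>k. y (Suc k)) x + z * kernel_form y x = - herm_inner (seq_apply (-1) y) (seq_apply (-1) x)" for y
    using kernel_form_shift[of y x] by (simp add: Sx kernel_form_right F(1))
  have "cnj z * kernel_form x x + z * kernel_form x x = - herm_inner (seq_apply (-1) x) (seq_apply (-1) x)"
    using shift[of x] by (simp add: Sx kernel_form_left)
  then have "Re (cnj z * kernel_form x x + z * kernel_form x x) = - Re (herm_inner (seq_apply (-1) x) (seq_apply (-1) x))"
    by simp
  then have *: "2 * Re z * Re (kernel_form x x) = - Re (herm_inner (seq_apply (-1) x) (seq_apply (-1) x))"
    by (simp add: Imx)
  then have "Re z * Re (kernel_form x x) \<le> 0" using herm_inner_self_Re[of "seq_apply (-1) x"] by linarith
  then have "Re z \<le> 0" using Kx by (simp add: mult_le_0_iff)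
  moreover have "Re z \<noteq> 0"
  proof
    assume "Re z = 0"
    then have "herm_inner (seq_apply (-1) x) (seq_apply (-1) x) = 0" using * by (simp add: complex_eq_iff)
    then have "seq_apply (-1) x = 0" by simp
    \<comment> \<open>On the axis the identity reads \<open>K((S + cnj z) y, x) = 0\<close> for
      every sequence \<open>y\<close>, where \<open>S\<close> is the shift. The recursion solves
      \<open>(S + cnj z) y = x\<close>, so \<open>K(x,x) = 0\<close>.\<close>
    define y where "y = rec_nat 0 (\<lambda>k yk. x k - cnj z *s yk)"
    have x: "x = (\<lambda>k. y (Suc k)) + (\<lambda>k. cnj z *s y k)" by (simp add: fun_eq_iff y_def)
    have "kernel_form x x' = kernel_form (\<lambda>k. y (Suc k)) x' + z * kernel_form y x'"
      by (subst x) (simp only: kernel_form_left complex_cnj_cnj)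
    then have "kernel_form x x = kernel_form (\<lambda>k. y (Suc k)) x + z * kernel_form y x" by (simp only: xx)
    then have "kernel_form x x = 0" using shift[of y] \<open>seq_apply (-1) x = 0\<close> by simp
    then show False using Kx by simp
  qed
  ultimately show ?thesis by simp
qed

end

section \<open>Reduction to block Hankel forms\<close>

lemma invertible_iff_ker: "invertible M \<longleftrightarrow> (\<forall>v. M *v v = 0 \<longrightarrow> v = 0)"
  for M :: "complex^'n^'n"
  using matrix_left_invertible_ker[of M] by (auto simp: invertible_left_inverse)

text \<open>On a state whose only entry is \<open>v\<close> at position \<open>N - 1\<close>, the
  form equals twice the inner product of \<open>v\<close> with \<open>f (N - 1) *v v\<close>,
  because \<open>f N\<close> is the identity. A kernel vector of \<open>f (N - 1)\<close> would
  therefore contradict positivity.\<close>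

lemma (in hermite_fujiwara) subleading_invertible:
  assumes positive
  shows "invertible (f (N - 1))"
  unfolding invertible_iff_ker
proof (intro allI impI, rule ccontr)
  fix v assume v: "f (N - 1) *v v = 0" "v \<noteq> 0"
  obtain n where n: "N = Suc n" using N by (cases N) auto
  define x where "x = (\<lambda>k. if k = n then v else 0)"
  have "x n \<noteq> 0" using v by (simp add: x_def)
  then have "x \<noteq> 0" by auto
  moreover have "\<forall>k\<ge>N. x k = 0" by (auto simp: x_def n)
  ultimately have "Re (kernel_form x x) > 0" using assms by (simp add: positive_def)
  moreover have "kernel_form x x = kernel_coeff n n v v"
  proof -
    have "kernel_form x x = (\<Sum>a<N. \<Sum>b<N. if b = n then if a = n then kernel_coeff n n v v else 0 else 0)"
      unfolding kernel_form_def by (intro sum.cong) (auto simp: x_def)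
    then show ?thesis by (simp add: n)
  qed
  moreover have "kernel_coeff n n v v = 0"
    unfolding kernel_coeff_def
  proof (intro sum.neutral ballI)
    fix i
    show "(-1) ^ i * num_coeff (n + 1 + i) (n - i) v v = 0"
      using v(1) high[of "n + 1 + i"] by (cases "i = 0") (auto simp: num_coeff_def n)
  qed
  ultimately show False by simp
qed

lemma sum_lessThan_add: "(\<Sum>k<b + n. g k) = (\<Sum>k<b. g k) + (\<Sum>k<n. g (b + k))"
  for g :: "nat \<Rightarrow> 'a::comm_monoid_add"
  by (induction n) (simp_all add: add_ac)

lemma sum_lessThan_even_odd: "(\<Sum>k<2 * n. g k) = (\<Sum>k<n. g (2 * k)) + (\<Sum>k<n. g (2 * k + 1))"
  for g :: "nat \<Rightarrow> 'a::comm_monoid_add"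
  by (induction n) (simp_all add: add_ac)

text \<open>
  \<open>s\<close> are the Laurent coefficients at infinity of \<open>F\<^sub>e F\<^sub>o\<^sup>-\<^sup>1\<close>, whose defining relation
  \<open>(\<Sum>j. s j z\<^bsup>-j-1\<^esup>) F\<^sub>o(z) = F\<^sub>e(z)\<close> is \<open>quotient\<close>.
\<close>
locale even_odd_quotient = hermite_fujiwara f "2 * m"
  for f :: "nat \<Rightarrow> complex^'n^'n" and m :: nat +
  fixes s :: "int \<Rightarrow> complex^'n^'n"
  assumes lead: "invertible (f (2 * m - 1))"
    and quotient: "\<And>b v. (\<Sum>k<m. s (int k - b - 1) *v (f (2 * k + 1) *v v))
        = (if b < 0 then 0 else f (2 * nat b) *v v)"
    and bounded: "\<exists>J. \<forall>j<J. s j = 0"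
begin

section \<open>Laurent coefficients of the quotient: growth and self-adjointness\<close>

definition odd_coeff :: "nat \<Rightarrow> complex^'n^'n" where "odd_coeff k = f (2 * k + 1)"
definition even_coeff :: "nat \<Rightarrow> complex^'n^'n" where "even_coeff k = f (2 * k)"

lemma m_pos: "m > 0" using N by simp

lemma odd_coeff_high: "k \<ge> m \<Longrightarrow> odd_coeff k = 0" and even_coeff_high: "k > m \<Longrightarrow> even_coeff k = 0"
  using high by (simp_all add: odd_coeff_def even_coeff_def)

lemma odd_coeff_lead: "invertible (odd_coeff (m - 1))"
proof -
  have "2 * (m - 1) + 1 = 2 * m - 1" using m_pos by simp
  with lead show ?thesis by (simp only: odd_coeff_def)
qed

text \<open>Integer indices let \<open>quotient\<close> be read at negative powers of
  \<open>z\<close> too, where it says that \<open>F_e\<close> has no such terms.\<close>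

definition even_coeff_int :: "int \<Rightarrow> complex^'n \<Rightarrow> complex^'n" where
  "even_coeff_int b v = (if b < 0 then 0 else even_coeff (nat b) *v v)"

lemma even_coeff_int_conv_sum: "even_coeff_int b v = (\<Sum>k<m. s (int k - b - 1) *v (odd_coeff k *v v))"
  using quotient by (simp add: even_coeff_int_def odd_coeff_def even_coeff_def)

lemma sum_eq_last:
  assumes "\<And>k. k < m - 1 \<Longrightarrow> g k = 0"
  shows "(\<Sum>k<m. g k) = g (m - 1)"
  using m_pos assms by (cases m) simp_all

text \<open>Strong induction over the integers, which needs a point below which the claim holds
  outright. For Laurent coefficients this is the finiteness of the expansion towards positive powers
  of \<open>z\<close>.\<close>

lemma vanishes_by_least:
  assumes "\<forall>j<J. P j" and "\<And>j::int. (\<And>i. i < j \<Longrightarrow> P i) \<Longrightarrow> P j"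
  shows "P j"
proof -
  have "\<forall>i < J + int n. P i" for n
  proof (induction n)
    case (Suc n)
    then have "P (J + int n)" using assms(2) by blast
    with Suc show ?case by (metis add.assoc int_Suc linorder_neqE_linordered_idom of_nat_Suc
        zle_add1_eq_le zless_add1_eq)
  qed (use assms(1) in simp)
  from this[of "nat (j + 1 - J)"] show ?thesis using assms(1) by (cases "j < J") auto
qed

text \<open>The degrees of \<open>F_e\<close> and \<open>F_o\<close> are \<open>m\<close> and
  \<open>m - 1\<close>, and the leading coefficient of \<open>F_o\<close> is invertible, so the
  quotient grows at most linearly.\<close>

lemma s_low: "j < -2 \<Longrightarrow> s j = 0"
proof -
  obtain J where J: "\<forall>j<J. s j = 0" using bounded by blast
  have "j < -2 \<longrightarrow> s j = 0"
  proof (rule vanishes_by_least[of J])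
    fix j assume IH: "\<And>i. i < j \<Longrightarrow> i < -2 \<longrightarrow> s i = 0"
    show "j < -2 \<longrightarrow> s j = 0"
    proof
      assume j: "j < -2"
      have "s j *v v = 0" for v
      proof -
        obtain w where w: "v = odd_coeff (m - 1) *v w"
          using odd_coeff_lead by (metis invertible_def matrix_vector_mul_assoc matrix_vector_mul_lid)
        \<comment> \<open>With this exponent \<open>s j\<close> meets the leading coefficient of
          \<open>F_o\<close>, all other summands have smaller index, and \<open>b > m\<close>
          exceeds the degree of \<open>F_e\<close>.\<close>
        define b where "b = int m - 2 - j"
        have "(\<Sum>k<m. s (int k - b - 1) *v (odd_coeff k *v w)) = 0"
          using even_coeff_int_conv_sum[of b w] j by (simp add: b_def even_coeff_int_def even_coeff_high)
        also have "(\<Sum>k<m. s (int k - b - 1) *v (odd_coeff k *v w)) = s (int (m - 1) - b - 1) *v v"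
          unfolding w
        proof (rule sum_eq_last)
          fix k assume "k < m - 1"
          then have "s (int k - b - 1) = 0" using j IH by (simp add: b_def)
          then show "s (int k - b - 1) *v (odd_coeff k *v w) = 0" by simp
        qed
        also have "int (m - 1) - b - 1 = j" using m_pos by (simp add: b_def)
        finally show ?thesis .
      qed
      then show "s j = 0" by (simp add: matrix_eq)
    qed
  qed (use J in auto)
  then show "j < -2 \<Longrightarrow> s j = 0" by simp
qed

lemma even_odd_alternating:
  "(\<Sum>j<Suc q. herm_inner (even_coeff j *v u) (odd_coeff (q - j) *v v)) = (\<Sum>j<Suc q. herm_inner (odd_coeff j *v u) (even_coeff (q - j) *v v))"
proof -
  have "0 = (\<Sum>i<2 * Suc q. (-1) ^ i * herm_inner (f i *v u) (f (2 * q + 1 - i) *v v))"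
    using alternating[of "2 * q + 1" u v] by (simp add: lessThan_Suc_atMost[symmetric] del: sum.lessThan_Suc)
  also have "\<dots> = (\<Sum>j<Suc q. herm_inner (even_coeff j *v u) (f (2 * q + 1 - 2 * j) *v v))
      - (\<Sum>j<Suc q. herm_inner (odd_coeff j *v u) (f (2 * q + 1 - (2 * j + 1)) *v v))"
    by (subst sum_lessThan_even_odd) (simp add: sum_negf odd_coeff_def even_coeff_def del: sum.lessThan_Suc)
  also have "(\<Sum>j<Suc q. herm_inner (even_coeff j *v u) (f (2 * q + 1 - 2 * j) *v v))
      = (\<Sum>j<Suc q. herm_inner (even_coeff j *v u) (odd_coeff (q - j) *v v))"
    by (rule sum.cong) (auto simp: less_Suc_eq_le diff_mult_distrib2 Suc_diff_le odd_coeff_def)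
  also have "(\<Sum>j<Suc q. herm_inner (odd_coeff j *v u) (f (2 * q + 1 - (2 * j + 1)) *v v))
      = (\<Sum>j<Suc q. herm_inner (odd_coeff j *v u) (even_coeff (q - j) *v v))"
    by (rule sum.cong) (auto simp: diff_mult_distrib2 even_coeff_def)
  finally show ?thesis by simp
qed

lemma even_odd_alternating_int:
  "(\<Sum>l<m. herm_inner (even_coeff_int (q - int l) u) (odd_coeff l *v v)) = (\<Sum>l<m. herm_inner (odd_coeff l *v u) (even_coeff_int (q - int l) v))"
proof (cases "q < 0")
  case True
  then show ?thesis by (simp add: even_coeff_int_def)
next
  case False
  then obtain n where q: "q = int n" by (metis nat_0_le not_less)
  have *: "(\<Sum>l<m. g l) = (\<Sum>l<Suc n. g l)" if "\<And>l. l > n \<Longrightarrow> g l = 0" "\<And>l. l \<ge> m \<Longrightarrow> g l = 0"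
    for g :: "nat \<Rightarrow> complex"
  proof -
    have "(\<Sum>l<m. g l) = (\<Sum>l<m + Suc n. g l)"
      by (rule sum.mono_neutral_left) (auto intro!: that(2))
    also have "\<dots> = (\<Sum>l<Suc n. g l)"
      by (rule sum.mono_neutral_right) (auto intro!: that(1))
    finally show ?thesis .
  qed
  have "(\<Sum>l<m. herm_inner (even_coeff_int (q - int l) u) (odd_coeff l *v v)) = (\<Sum>l<Suc n. herm_inner (even_coeff_int (q - int l) u) (odd_coeff l *v v))"
    by (rule *) (simp_all add: even_coeff_int_def q odd_coeff_high)
  also have "\<dots> = (\<Sum>l<Suc n. herm_inner (even_coeff (n - l) *v u) (odd_coeff l *v v))"
    by (rule sum.cong) (auto simp: even_coeff_int_def q nat_diff_distrib)
  also have "\<dots> = (\<Sum>l<Suc n. herm_inner (even_coeff l *v u) (odd_coeff (n - l) *v v))"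
    by (rule sum.reindex_bij_witness[of _ "\<lambda>l. n - l" "\<lambda>l. n - l"]) auto
  also have "\<dots> = (\<Sum>l<Suc n. herm_inner (odd_coeff l *v u) (even_coeff (n - l) *v v))"
    by (rule even_odd_alternating)
  also have "\<dots> = (\<Sum>l<Suc n. herm_inner (odd_coeff l *v u) (even_coeff_int (q - int l) v))"
    by (rule sum.cong) (auto simp: even_coeff_int_def q nat_diff_distrib)
  also have "\<dots> = (\<Sum>l<m. herm_inner (odd_coeff l *v u) (even_coeff_int (q - int l) v))"
    by (rule *[symmetric]) (simp_all add: even_coeff_int_def q odd_coeff_high)
  finally show ?thesis .
qed

text \<open>Substituting \<open>F_e = W F_o\<close> into \<open>F_e^* F_o = F_o^* F_e\<close> gives
  \<open>F_o^* (W^* - W) F_o = 0\<close>. The factors \<open>F_o\<close> are cancelled coefficient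
  by coefficient, starting from the highest power of \<open>z\<close>.\<close>

lemma s_selfadjoint: "herm_inner (s j *v u) v = herm_inner u (s j *v v)"
proof -
  define d where "d = (\<lambda>j u v. herm_inner (s j *v u) v - herm_inner u (s j *v v))"
  have d0: "d j u 0 = 0" "d j 0 v = 0" for j u v by (simp_all add: d_def)
  have sum0: "(\<Sum>l<m. \<Sum>k<m. d (int k + int l - c) (odd_coeff k *v u) (odd_coeff l *v v)) = 0" for c u v
  proof -
    have "(\<Sum>l<m. herm_inner (even_coeff_int (c - 1 - int l) u) (odd_coeff l *v v))
        = (\<Sum>l<m. \<Sum>k<m. herm_inner (s (int k + int l - c) *v (odd_coeff k *v u)) (odd_coeff l *v v))"
      by (simp add: even_coeff_int_conv_sum herm_inner_sum algebra_simps)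
    moreover have "(\<Sum>l<m. herm_inner (odd_coeff l *v u) (even_coeff_int (c - 1 - int l) v))
        = (\<Sum>l<m. \<Sum>k<m. herm_inner (odd_coeff k *v u) (s (int k + int l - c) *v (odd_coeff l *v v)))"
      by (subst sum.swap) (simp add: even_coeff_int_conv_sum herm_inner_sum algebra_simps)
    ultimately show ?thesis
      using even_odd_alternating_int[of "c - 1" u v] by (simp add: d_def sum_subtractf)
  qed
  have "\<forall>u v. d j u v = 0"
  proof (rule vanishes_by_least[of "-2"])
    fix j assume IH: "\<And>i. i < j \<Longrightarrow> \<forall>u v. d i u v = 0"
    show "\<forall>u v. d j u v = 0"
    proof (intro allI)
      fix u v
      obtain u' v' where uv: "u = odd_coeff (m - 1) *v u'" "v = odd_coeff (m - 1) *v v'"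
        using odd_coeff_lead by (metis invertible_def matrix_vector_mul_assoc matrix_vector_mul_lid)
      \<comment> \<open>Now the index \<open>j\<close> occurs exactly at
        \<open>k = l = m - 1\<close>, with the invertible leading coefficient on both sides; every
        other pair has a smaller index.\<close>
      define c where "c = 2 * int (m - 1) - j"
      have z: "d (int k + int l - c) x y = 0" if "int k + int l < 2 * int (m - 1)" for k l x y
        using IH[of "int k + int l - c"] that by (simp add: c_def)
      have "0 = (\<Sum>l<m. \<Sum>k<m. d (int k + int l - c) (odd_coeff k *v u') (odd_coeff l *v v'))"
        using sum0 by simp
      also have "\<dots> = (\<Sum>k<m. d (int k + int (m - 1) - c) (odd_coeff k *v u') v)"
        unfolding uv by (rule sum_eq_last) (auto intro!: sum.neutral z)
      also have "\<dots> = d (int (m - 1) + int (m - 1) - c) u v"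
        unfolding uv by (rule sum_eq_last) (rule z, simp)
      finally show "d j u v = 0" by (simp add: c_def)
    qed
  qed (simp add: d_def s_low)
  then show ?thesis by (simp add: d_def)
qed

lemma herm_inner_s_commute: "herm_inner u (s j *v v) = cnj (herm_inner v (s j *v u))"
  by (metis herm_inner_commute s_selfadjoint)

text \<open>The coefficient of \<open>z^(b+1)\<close> in \<open>W F_o\<close>, in which
  \<open>s_low\<close> removes every summand with \<open>k < b\<close>.\<close>

lemma even_coeff_Suc: "even_coeff (Suc b) *v v = s (-2) *v (odd_coeff b *v v) + (\<Sum>d<m. s (int d - 1) *v (odd_coeff (b + 1 + d) *v v))"
proof -
  define g where "g = (\<lambda>k. s (int k - int b - 2) *v (odd_coeff k *v v))"
  have "even_coeff (Suc b) *v v = (\<Sum>k<m. g k)"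
    using even_coeff_int_conv_sum[of "int (Suc b)" v] by (simp add: g_def even_coeff_int_def nat_add_distrib diff_diff_eq add.commute)
  also have "\<dots> = (\<Sum>k<b + Suc m. g k)"
    by (rule sum.mono_neutral_left) (auto simp: g_def odd_coeff_high)
  also have "\<dots> = (\<Sum>k<b. g k) + (\<Sum>k<Suc m. g (b + k))"
    by (rule sum_lessThan_add)
  also have "(\<Sum>k<b. g k) = 0"
    by (rule sum.neutral) (simp add: g_def s_low)
  also have "(\<Sum>k<Suc m. g (b + k)) = g b + (\<Sum>d<m. g (b + 1 + d))"
    by (subst sum.lessThan_Suc_shift) simp
  finally show ?thesis by (simp add: g_def)
qed

text \<open>The even and odd parts of the kernel, halved, as congruence transforms of block Hankel matrices.\<close>

definition even_kernel :: "nat \<Rightarrow> nat \<Rightarrow> complex^'n \<Rightarrow> complex^'n \<Rightarrow> complex" where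
  "even_kernel a b u v = (\<Sum>c<m. \<Sum>d<m. herm_inner (odd_coeff (a + c) *v u) (s (int c + int d - 1) *v (odd_coeff (b + d) *v v)))"

definition odd_kernel :: "nat \<Rightarrow> nat \<Rightarrow> complex^'n \<Rightarrow> complex^'n \<Rightarrow> complex" where
  "odd_kernel a b u v = herm_inner (odd_coeff a *v u) (s (-2) *v (odd_coeff b *v v)) -
     (\<Sum>c<m. \<Sum>d<m. herm_inner (odd_coeff (a + 1 + c) *v u) (s (int c + int d) *v (odd_coeff (b + 1 + d) *v v)))"

lemma even_kernel_commute: "even_kernel a b u v = cnj (even_kernel b a v u)"
  unfolding even_kernel_def
  by (subst sum.swap) (simp add: herm_inner_s_commute[of "odd_coeff (a + _) *v u"] add.commute[of "int _" "int _"])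

lemma odd_kernel_commute: "odd_kernel a b u v = cnj (odd_kernel b a v u)"
  unfolding odd_kernel_def
  by (subst sum.swap)
     (simp add: herm_inner_s_commute[of "odd_coeff (Suc (a + _)) *v u"] herm_inner_s_commute[of "odd_coeff a *v u"]
       add.commute[of "int _" "int _"])

lemma even_kernel_split:
  "even_kernel a b u v = (\<Sum>d<m. herm_inner (odd_coeff a *v u) (s (int d - 1) *v (odd_coeff (b + d) *v v))) +
     (\<Sum>c<m. \<Sum>d<m. herm_inner (odd_coeff (a + 1 + c) *v u) (s (int c + int d) *v (odd_coeff (b + d) *v v)))"
proof -
  define g where "g = (\<lambda>c. \<Sum>d<m. herm_inner (odd_coeff (a + c) *v u) (s (int c + int d - 1) *v (odd_coeff (b + d) *v v)))"
  have "even_kernel a b u v = (\<Sum>c<Suc m. g c)"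
    by (simp add: even_kernel_def g_def odd_coeff_high)
  also have "\<dots> = g 0 + (\<Sum>c<m. g (Suc c))" by (rule sum.lessThan_Suc_shift)
  finally show ?thesis by (simp add: g_def)
qed

text \<open>Row \<open>c\<close> of the Hankel sum, applied to the coefficients of
  \<open>F_o\<close>, is the coefficient of \<open>z^(-c)\<close> in \<open>W F_o = F_e\<close>;
  only \<open>c = 0\<close> contributes.\<close>

lemma even_kernel_0: "even_kernel a 0 u v = herm_inner (odd_coeff a *v u) (even_coeff 0 *v v)"
proof -
  have "(\<Sum>d<m. s (int d - 1) *v (odd_coeff d *v v)) = even_coeff 0 *v v"
    using even_coeff_int_conv_sum[of 0 v] by (simp add: even_coeff_int_def)
  moreover have "(\<Sum>d<m. s (int c + int d) *v (odd_coeff d *v v)) = 0" for c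
    using even_coeff_int_conv_sum[of "- int c - 1" v] by (simp add: even_coeff_int_def add.commute)
  ultimately show ?thesis
    unfolding even_kernel_split by (simp add: herm_inner_sum[symmetric])
qed

text \<open>The double sum in \<open>odd_kernel\<close> cancels the one left over in
  \<open>even_kernel_split\<close>; the rest is \<open>even_coeff_Suc\<close>.\<close>

lemma even_odd_kernel: "even_kernel a (Suc b) u v + odd_kernel a b u v = herm_inner (odd_coeff a *v u) (even_coeff (Suc b) *v v)"
  unfolding even_kernel_split odd_kernel_def even_coeff_Suc by (simp add: herm_inner_add herm_inner_sum)

lemma odd_even_kernel: "odd_kernel a b u v + even_kernel (Suc a) b u v = herm_inner (even_coeff (Suc a) *v u) (odd_coeff b *v v)"
proof -
  have "odd_kernel a b u v + even_kernel (Suc a) b u v = cnj (even_kernel b (Suc a) v u + odd_kernel b a v u)"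
    using even_kernel_commute[of "Suc a" b u v] odd_kernel_commute[of a b u v] by simp
  also have "\<dots> = herm_inner (even_coeff (Suc a) *v u) (odd_coeff b *v v)"
    unfolding even_odd_kernel by (rule herm_inner_commute[symmetric])
  finally show ?thesis .
qed

text \<open>Each step of the recursion for \<open>kernel_coeff\<close> flips the parity of both
  indices, so the relations between the two halves reproduce it. Mixed parities vanish because the
  numerator has only terms of odd total degree.\<close>

lemma kernel_coeff_conv:
  "kernel_coeff a b u v = (if even a \<and> even b then 2 * even_kernel (a div 2) (b div 2) u v
                 else if odd a \<and> odd b then 2 * odd_kernel (a div 2) (b div 2) u v else 0)"
proof (induction b arbitrary: a)
  case 0
  show ?case
  proof (cases "even a")
    case True
    then obtain a' where "a = 2 * a'" by blast
    then show ?thesis by (simp add: kernel_coeff_0 even_kernel_0 num_coeff_def odd_coeff_def even_coeff_def)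
  qed (simp add: kernel_coeff_0 num_coeff_def)
next
  case (Suc b)
  consider a' b' where "a = 2 * a'" "b = 2 * b' + 1" | a' b' where "a = 2 * a' + 1" "b = 2 * b'"
    | "even a = even b"
    by (metis evenE oddE)
  then show ?case
  proof cases
    case 1
    then show ?thesis
      using Suc.IH[of "Suc a"] even_odd_kernel[of a' b' u v, symmetric]
      by (simp add: kernel_coeff_Suc num_coeff_def odd_coeff_def even_coeff_def distrib_left)
  next
    case 2
    then show ?thesis
      using Suc.IH[of "Suc a"] odd_even_kernel[of a' b' u v, symmetric]
      by (simp add: kernel_coeff_Suc num_coeff_def odd_coeff_def even_coeff_def distrib_left)
  next
    case 3
    then show ?thesis
      using Suc.IH[of "Suc a"] by (auto simp add: kernel_coeff_Suc num_coeff_def)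
  qed
qed

text \<open>The change of coordinates realising the congruence. Its matrix
  \<open>[odd_coeff (a + c)]\<close> vanishes for \<open>a + c \<ge> m\<close> and carries the
  invertible leading coefficient of \<open>F_o\<close> on the antidiagonal.\<close>

definition hankel_coord :: "(nat \<Rightarrow> complex^'n) \<Rightarrow> nat \<Rightarrow> complex^'n" where
  "hankel_coord x c = (\<Sum>a<m. odd_coeff (a + c) *v x a)"

lemma hankel_coord_high: "c \<ge> m \<Longrightarrow> hankel_coord x c = 0"
  by (simp add: hankel_coord_def odd_coeff_high)

lemma hankel_coord_zero: "(\<And>k. x k = 0) \<Longrightarrow> hankel_coord x c = 0"
  by (simp add: hankel_coord_def)

lemma sum_herm_inner_hankel_coord:
  "(\<Sum>a<m. \<Sum>b<m. herm_inner (odd_coeff (a + c) *v x a) (T *v (odd_coeff (b + d) *v x b))) = herm_inner (hankel_coord x c) (T *v hankel_coord x d)"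
  unfolding hankel_coord_def herm_inner_sum matrix_vector_mult_sum by (rule sum.swap)

lemma sum_swap_inner:
  "(\<Sum>a<m. \<Sum>b<m. \<Sum>c<m. \<Sum>d<m. g a b c d) = (\<Sum>c<m. \<Sum>d<m. \<Sum>a<m. \<Sum>b<m. g a b c d)"
  for g :: "nat \<Rightarrow> nat \<Rightarrow> nat \<Rightarrow> nat \<Rightarrow> complex"
proof -
  have pairs: "(\<Sum>a<m. \<Sum>b<m. h a b) = (\<Sum>p\<in>{..<m} \<times> {..<m}. h (fst p) (snd p))"
    for h :: "nat \<Rightarrow> nat \<Rightarrow> complex"
    by (simp add: sum.cartesian_product case_prod_unfold)
  show ?thesis unfolding pairs by (rule sum.swap)
qed

lemma sum_even_kernel: "(\<Sum>a<m. \<Sum>b<m. even_kernel a b (x a) (x b))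
    = (\<Sum>c<m. \<Sum>d<m. herm_inner (hankel_coord x c) (s (int c + int d - 1) *v hankel_coord x d))"
  unfolding even_kernel_def by (subst sum_swap_inner) (simp only: sum_herm_inner_hankel_coord)

text \<open>Coordinate 0 decouples and meets only \<open>s (-2)\<close>. Coordinate \<open>m\<close>
  is zero, so the remaining Hankel matrix has order \<open>m - 1\<close>, and is empty for
  \<open>m = 1\<close>.\<close>

lemma sum_odd_kernel: "(\<Sum>a<m. \<Sum>b<m. odd_kernel a b (x a) (x b)) = herm_inner (hankel_coord x 0) (s (-2) *v hankel_coord x 0)
    - (\<Sum>c<m - 1. \<Sum>d<m - 1. herm_inner (hankel_coord x (Suc c)) (s (int c + int d) *v hankel_coord x (Suc d)))"
proof -
  have "(\<Sum>a<m. \<Sum>b<m. odd_kernel a b (x a) (x b)) = herm_inner (hankel_coord x 0) (s (-2) *v hankel_coord x 0)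
      - (\<Sum>c<m. \<Sum>d<m. herm_inner (hankel_coord x (1 + c)) (s (int c + int d) *v hankel_coord x (1 + d)))"
    unfolding odd_kernel_def sum_subtractf
    by (subst sum_swap_inner)
       (simp only: add.assoc sum_herm_inner_hankel_coord sum_herm_inner_hankel_coord[of 0 _ _ 0, unfolded add_0_right])
  also have "(\<Sum>c<m. \<Sum>d<m. herm_inner (hankel_coord x (1 + c)) (s (int c + int d) *v hankel_coord x (1 + d)))
      = (\<Sum>c<m - 1. \<Sum>d<m - 1. herm_inner (hankel_coord x (Suc c)) (s (int c + int d) *v hankel_coord x (Suc d)))"
  proof -
    obtain n where "m = Suc n" using m_pos by (cases m) auto
    then show ?thesis using hankel_coord_high[of "Suc n"] by simp
  qed
  finally show ?thesis .
qed

lemma kernel_form_conv: "kernel_form x x =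
    2 * (\<Sum>c<m. \<Sum>d<m. herm_inner (hankel_coord (\<lambda>k. x (2 * k)) c) (s (int c + int d - 1) *v hankel_coord (\<lambda>k. x (2 * k)) d))
  + 2 * (herm_inner (hankel_coord (\<lambda>k. x (2 * k + 1)) 0) (s (-2) *v hankel_coord (\<lambda>k. x (2 * k + 1)) 0)
    - (\<Sum>c<m - 1. \<Sum>d<m - 1. herm_inner (hankel_coord (\<lambda>k. x (2 * k + 1)) (Suc c)) (s (int c + int d) *v hankel_coord (\<lambda>k. x (2 * k + 1)) (Suc d))))"
  unfolding kernel_form_def sum_lessThan_even_odd sum_even_kernel[symmetric] sum_odd_kernel[symmetric]
  by (simp add: kernel_coeff_conv sum_distrib_left)

text \<open>Substitution in a triangular system: coordinate \<open>m - 1 - k\<close> involves only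
  \<open>x 0\<close> to \<open>x k\<close>, with an invertible coefficient at
  \<open>x k\<close>.\<close>

lemma hankel_coord_inj:
  assumes "\<And>c. c < m \<Longrightarrow> hankel_coord x c = 0" "k < m"
  shows "x k = 0"
  using assms(2)
proof (induction k rule: less_induct)
  case (less k)
  have "0 = (\<Sum>a<m. odd_coeff (a + (m - 1 - k)) *v x a)"
    using assms(1)[of "m - 1 - k"] m_pos by (simp add: hankel_coord_def)
  also have "\<dots> = (\<Sum>a\<in>{k}. odd_coeff (a + (m - 1 - k)) *v x a)"
  proof (rule sum.mono_neutral_right)
    show "\<forall>a\<in>{..<m} - {k}. odd_coeff (a + (m - 1 - k)) *v x a = 0"
    proof
      fix a assume a: "a \<in> {..<m} - {k}"
      show "odd_coeff (a + (m - 1 - k)) *v x a = 0"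
      proof (cases "a < k")
        case True
        then show ?thesis using less by simp
      next
        case False
        then have "a + (m - 1 - k) \<ge> m" using a less.prems by auto
        then show ?thesis by (simp only: odd_coeff_high matrix_vector_mult_0)
      qed
    qed
  qed (use less in auto)
  finally have "odd_coeff (m - 1) *v x k = 0" using less.prems by simp
  then show ?case using odd_coeff_lead by (auto simp: invertible_iff_ker)
qed

lemma hankel_coord_surj: "\<exists>x. (\<forall>k\<ge>m. x k = 0) \<and> (\<forall>c<m. hankel_coord x c = y c)"
proof -
  obtain B where B: "odd_coeff (m - 1) ** B = mat 1" using odd_coeff_lead by (auto simp: invertible_def)
  have "\<exists>x. (\<forall>k\<ge>j. x k = 0) \<and> (\<forall>c<m. m - j \<le> c \<longrightarrow> hankel_coord x c = y c)" if "j \<le> m" for j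
    using that
  proof (induction j)
    case 0
    then show ?case by (intro exI[of _ "\<lambda>_. 0"]) auto
  next
    case (Suc j)
    then obtain x where x: "\<forall>k\<ge>j. x k = 0" "\<forall>c<m. m - j \<le> c \<longrightarrow> hankel_coord x c = y c" by auto
    \<comment> \<open>A new entry at position \<open>j\<close> reaches only coordinates up to
      \<open>m - 1 - j\<close>. It therefore leaves the coordinates already matched untouched, and
      \<open>w\<close> is chosen to match the next one.\<close>
    define w where "w = B *v (y (m - 1 - j) - hankel_coord x (m - 1 - j))"
    define x' where "x' = x(j := w)"
    have eta': "hankel_coord x' c = hankel_coord x c + odd_coeff (j + c) *v w" for c
    proof -
      have "hankel_coord x' c = (\<Sum>a<m. odd_coeff (a + c) *v x a + (if a = j then odd_coeff (j + c) *v w else 0))"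
        unfolding hankel_coord_def by (rule sum.cong) (use x in \<open>auto simp: x'_def\<close>)
      then show ?thesis using Suc.prems by (simp add: sum.distrib hankel_coord_def)
    qed
    have "hankel_coord x' c = y c" if c: "c < m" "m - Suc j \<le> c" for c
    proof (cases "c = m - 1 - j")
      case True
      then have "j + c = m - 1" using Suc.prems by simp
      then have "odd_coeff (j + c) *v w = y c - hankel_coord x c"
        using B True by (simp add: w_def matrix_vector_mul_assoc)
      then show ?thesis by (simp add: eta')
    next
      case False
      then have "m - j \<le> c" "j + c \<ge> m" using c Suc.prems by auto
      then have "odd_coeff (j + c) = 0" "hankel_coord x c = y c" using x c by (auto simp: odd_coeff_high)
      then show ?thesis by (simp only: eta') simp
    qed
    moreover have "\<forall>k\<ge>Suc j. x' k = 0" using x by (simp add: x'_def)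
    ultimately show ?case by blast
  qed
  from this[of m] show ?thesis by simp
qed

text \<open>Order \<open>n\<close> counts blocks, so \<open>H_k\<close> has order
  \<open>k + 1\<close>. Offset 0 belongs to \<open>R_tilde\<close>, offset -1 to
  \<open>R_tilde_z\<close> with reversed sign.\<close>

definition hankel_form :: "nat \<Rightarrow> int \<Rightarrow> (nat \<Rightarrow> complex^'n) \<Rightarrow> real" where
  "hankel_form n i y = Re (\<Sum>c<n. \<Sum>d<n. herm_inner (y c) (s (int c + int d + i) *v y d))"

lemma hankel_form_zero: "(\<And>c. c < n \<Longrightarrow> y c = 0) \<Longrightarrow> hankel_form n i y = 0"
  by (simp add: hankel_form_def)

lemma hankel_form_cong: "(\<And>c. c < n \<Longrightarrow> y c = y' c) \<Longrightarrow> hankel_form n i y = hankel_form n i y'"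
  by (simp add: hankel_form_def)

lemma Re_kernel_form: "Re (kernel_form x x) = 2 * hankel_form m (-1) (hankel_coord (\<lambda>k. x (2 * k)))
    + 2 * (Re (herm_inner (hankel_coord (\<lambda>k. x (2 * k + 1)) 0) (s (-2) *v hankel_coord (\<lambda>k. x (2 * k + 1)) 0))
      - hankel_form (m - 1) 0 (\<lambda>c. hankel_coord (\<lambda>k. x (2 * k + 1)) (Suc c)))"
  unfolding kernel_form_conv hankel_form_def by simp

text \<open>Even and odd entries of a state are independent, and within each parity the coordinates
  can be prescribed freely, so each of the three forms can be isolated.\<close>

lemma positive_iff:
  "positive \<longleftrightarrow> (\<forall>y. (\<exists>c<m - 1. y c \<noteq> 0) \<longrightarrow> hankel_form (m - 1) 0 y < 0) \<and>
     (\<forall>y. (\<exists>c<m. y c \<noteq> 0) \<longrightarrow> hankel_form m (-1) y > 0) \<and>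
     (\<forall>v. v \<noteq> 0 \<longrightarrow> Re (herm_inner v (s (-2) *v v)) > 0)"
  (is "_ \<longleftrightarrow> ?A \<and> ?B \<and> ?C")
proof
  assume pos: positive
  have pos': "Re (kernel_form x x) > 0" if "\<And>k. k \<ge> 2 * m \<Longrightarrow> x k = 0" "x k \<noteq> 0" for x k
  proof -
    have "x \<noteq> 0" using that(2) by auto
    then show ?thesis using pos that(1) by (auto simp: positive_def)
  qed
  have B: ?B
  proof (intro allI impI)
    fix y :: "nat \<Rightarrow> complex^'n" assume "\<exists>c<m. y c \<noteq> 0"
    then obtain c where c: "c < m" "y c \<noteq> 0" by blast
    obtain X where X: "\<forall>k\<ge>m. X k = 0" "\<forall>c<m. hankel_coord X c = y c" using hankel_coord_surj by blast
    define x where "x = (\<lambda>k. if even k then X (k div 2) else 0)"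
    have x: "(\<lambda>k. x (2 * k)) = X" "(\<lambda>k. x (2 * k + 1)) = (\<lambda>_. 0)" by (auto simp: x_def)
    have "hankel_coord X c \<noteq> 0" using X c by simp
    then obtain k where "X k \<noteq> 0" by (metis hankel_coord_zero)
    moreover have "x (2 * k) = X k" using fun_cong[OF x(1)] .
    ultimately have "x (2 * k) \<noteq> 0" by simp
    moreover have "x j = 0" if "j \<ge> 2 * m" for j using X that by (simp add: x_def)
    ultimately have "Re (kernel_form x x) > 0" by (intro pos')
    then have "hankel_form m (-1) (hankel_coord X) > 0"
      unfolding Re_kernel_form x by (simp add: hankel_coord_def hankel_form_zero)
    then show "hankel_form m (-1) y > 0" using X hankel_form_cong[of m "hankel_coord X" y] by simp
  qed
  have AC: "Re (herm_inner (y 0) (s (-2) *v y 0)) - hankel_form (m - 1) 0 (\<lambda>c. y (Suc c)) > 0"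
    if "\<exists>c<m. y c \<noteq> 0" for y
  proof -
    from that obtain c where c: "c < m" "y c \<noteq> 0" by blast
    obtain X where X: "\<forall>k\<ge>m. X k = 0" "\<forall>c<m. hankel_coord X c = y c" using hankel_coord_surj by blast
    define x where "x = (\<lambda>k. if odd k then X (k div 2) else 0)"
    have x: "(\<lambda>k. x (2 * k)) = (\<lambda>_. 0)" "(\<lambda>k. x (2 * k + 1)) = X" by (auto simp: x_def)
    have "hankel_coord X c \<noteq> 0" using X c by simp
    then obtain k where "X k \<noteq> 0" by (metis hankel_coord_zero)
    moreover have "x (2 * k + 1) = X k" using fun_cong[OF x(2)] .
    ultimately have "x (2 * k + 1) \<noteq> 0" by simp
    moreover have "x j = 0" if "j \<ge> 2 * m" for j using X that by (simp add: x_def)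
    ultimately have "Re (kernel_form x x) > 0" by (intro pos')
    then have "Re (herm_inner (hankel_coord X 0) (s (-2) *v hankel_coord X 0)) - hankel_form (m - 1) 0 (\<lambda>c. hankel_coord X (Suc c)) > 0"
      unfolding Re_kernel_form x by (simp add: hankel_coord_def hankel_form_zero)
    then show ?thesis using X m_pos hankel_form_cong[of "m - 1" "\<lambda>c. hankel_coord X (Suc c)" "\<lambda>c. y (Suc c)" 0] by simp
  qed
  have ?A
  proof (intro allI impI)
    fix y :: "nat \<Rightarrow> complex^'n" assume "\<exists>c<m - 1. y c \<noteq> 0"
    then obtain c where "c < m - 1" "y c \<noteq> 0" by blast
    then have "Suc c < m" "case_nat 0 y (Suc c) \<noteq> 0" by auto
    \<comment> \<open>A zero in front of \<open>y\<close> switches off the term with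
      \<open>s (-2)\<close>; the next claim switches off the Hankel term instead.\<close>
    then show "hankel_form (m - 1) 0 y < 0" using AC[of "case_nat 0 y"] by fastforce
  qed
  moreover have ?C
  proof (intro allI impI)
    fix v :: "complex^'n" assume "v \<noteq> 0"
    then have "\<exists>c<m. case_nat v (\<lambda>_. 0) c \<noteq> 0" using m_pos by (intro exI[of _ 0]) auto
    then show "Re (herm_inner v (s (-2) *v v)) > 0"
      using AC[of "case_nat v (\<lambda>_. 0)"] by (simp add: hankel_form_zero)
  qed
  ultimately show "?A \<and> ?B \<and> ?C" using B by blast
next
  assume ABC: "?A \<and> ?B \<and> ?C"
  note A' = ABC[THEN conjunct1, rule_format] and B' = ABC[THEN conjunct2, THEN conjunct1, rule_format]
    and C' = ABC[THEN conjunct2, THEN conjunct2, rule_format]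
  have A: "hankel_form (m - 1) 0 y \<le> 0" for y
  proof (cases "\<exists>c<m - 1. y c \<noteq> 0")
    case True
    then show ?thesis by (intro less_imp_le A')
  next
    case False
    then show ?thesis using hankel_form_zero[of "m - 1" y 0] by simp
  qed
  have B: "hankel_form m (-1) y \<ge> 0" for y
  proof (cases "\<exists>c<m. y c \<noteq> 0")
    case True
    then show ?thesis by (intro less_imp_le B')
  next
    case False
    then show ?thesis using hankel_form_zero[of m y "-1"] by simp
  qed
  have arith: "2 * a + 2 * (c - b) > 0" if "a \<ge> 0" "b \<le> 0" "c \<ge> 0" "a > 0 \<or> b < 0 \<or> c > 0"
    for a b c :: real using that by auto
  have C: "Re (herm_inner v (s (-2) *v v)) \<ge> 0" for v
    using C'[of v] by (cases "v = 0") simp_all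
  show positive
    unfolding positive_def
  proof (intro allI impI)
    fix x :: "nat \<Rightarrow> complex^'n" assume x: "\<forall>k\<ge>2 * m. x k = 0" "x \<noteq> 0"
    define X where "X = (\<lambda>k. x (2 * k))"
    define Y where "Y = (\<lambda>k. x (2 * k + 1))"
    have K: "Re (kernel_form x x) = 2 * hankel_form m (-1) (hankel_coord X)
        + 2 * (Re (herm_inner (hankel_coord Y 0) (s (-2) *v hankel_coord Y 0)) - hankel_form (m - 1) 0 (\<lambda>c. hankel_coord Y (Suc c)))"
      unfolding X_def Y_def by (rule Re_kernel_form)
    from x obtain k where k: "x k \<noteq> 0" by (auto simp: fun_eq_iff)
    with x have "k < 2 * m" by (meson not_le)
    then have "(\<exists>k<m. X k \<noteq> 0) \<or> (\<exists>k<m. Y k \<noteq> 0)"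
      using k by (cases "even k") (auto simp: X_def Y_def elim!: evenE oddE)
    then consider "\<exists>c<m. hankel_coord X c \<noteq> 0" | c where "c < m" "hankel_coord Y c \<noteq> 0" using hankel_coord_inj by blast
    then show "Re (kernel_form x x) > 0"
    proof cases
      case 1
      then have "hankel_form m (-1) (hankel_coord X) > 0" by (rule B')
      then show ?thesis unfolding K by (intro arith[OF B A C]) simp
    next
      case (2 c)
      show ?thesis
      proof (cases c)
        case 0
        then have "hankel_coord Y 0 \<noteq> 0" using 2 by simp
        then have "Re (herm_inner (hankel_coord Y 0) (s (-2) *v hankel_coord Y 0)) > 0" by (rule C')
        then show ?thesis unfolding K by (intro arith[OF B A C]) simp
      next
        case (Suc c')
        then have "c' < m - 1 \<and> hankel_coord Y (Suc c') \<noteq> 0" using 2 by auto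
        then have "hankel_form (m - 1) 0 (\<lambda>c. hankel_coord Y (Suc c)) < 0" by (intro A') (rule exI)
        then show ?thesis unfolding K by (intro arith[OF B A C]) simp
      qed
    qed
  qed
qed

end

section \<open>Rational functions at infinity\<close>

text \<open>Poles are defined by the reduced quotient, but any denominator nonzero at
  \<open>z\<close> will do: if the reduced denominator vanished there, so would the reduced
  numerator, against coprimality.\<close>

lemma rf_eval_quotient:
  assumes r: "r * to_fract b = to_fract a" and b: "poly b z \<noteq> 0"
  shows "\<not> rf_pole r z" "rf_eval r z = poly a z / poly b z"
proof -
  define n d where "n = fst (quot_of_fract r)" and "d = snd (quot_of_fract r)"
  have "d \<noteq> 0" by (simp add: d_def)
  then have rd: "r * to_fract d = to_fract n"
    using Fract_quot_of_fract[of r] by (simp add: n_def d_def Fract_conv_to_fract field_simps)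
  have "to_fract (a * d) = to_fract (n * b)"
    by (simp add: r[symmetric] rd[symmetric])
  then have "a * d = n * b" by (simp only: to_fract_eq_iff)
  from arg_cong[OF this, of "\<lambda>p. poly p z"]
  have eq: "poly a z * poly d z = poly n z * poly b z" by simp
  have "poly d z \<noteq> 0"
  proof
    assume "poly d z = 0"
    with eq b have "poly n z = 0" by simp
    with \<open>poly d z = 0\<close> have "[:-z, 1:] dvd n" "[:-z, 1:] dvd d" by (simp_all add: poly_eq_0_iff_dvd)
    moreover have "coprime n d" unfolding n_def d_def by (rule coprime_quot_of_fract)
    ultimately have "is_unit [:-z, 1:]" by (meson coprime_common_divisor)
    then show False by (simp add: is_unit_poly_iff)
  qed
  then show "\<not> rf_pole r z" "rf_eval r z = poly a z / poly b z"
    using eq b by (simp_all add: rf_pole_def rf_eval_def n_def d_def field_simps)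
qed

lemma rf_times_snd: "r * to_fract (snd (quot_of_fract r)) = to_fract (fst (quot_of_fract r))"
  using Fract_quot_of_fract[of r] by (simp add: Fract_conv_to_fract field_simps)

lemma rf_eval_to_fract: "\<not> rf_pole (to_fract p) z" "rf_eval (to_fract p) z = poly p z"
  by (simp_all add: rf_pole_def rf_eval_def)

lemma rf_eval_add:
  assumes "\<not> rf_pole r z" "\<not> rf_pole t z"
  shows "\<not> rf_pole (r + t) z" "rf_eval (r + t) z = rf_eval r z + rf_eval t z"
proof -
  let ?n = "\<lambda>r. fst (quot_of_fract r)" and ?d = "\<lambda>r. snd (quot_of_fract r)"
  have "(r + t) * to_fract (?d r * ?d t)
      = (r * to_fract (?d r)) * to_fract (?d t) + (t * to_fract (?d t)) * to_fract (?d r)"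
    by (simp add: algebra_simps)
  also have "\<dots> = to_fract (?n r * ?d t + ?n t * ?d r)" unfolding rf_times_snd by simp
  finally have *: "(r + t) * to_fract (?d r * ?d t) = to_fract (?n r * ?d t + ?n t * ?d r)" .
  have nz: "poly (?d r * ?d t) z \<noteq> 0" using assms by (simp add: rf_pole_def)
  show "\<not> rf_pole (r + t) z" "rf_eval (r + t) z = rf_eval r z + rf_eval t z"
    using rf_eval_quotient[OF * nz] nz by (simp_all add: rf_eval_def add_divide_distrib)
qed

lemma rf_eval_mult:
  assumes "\<not> rf_pole r z" "\<not> rf_pole t z"
  shows "\<not> rf_pole (r * t) z" "rf_eval (r * t) z = rf_eval r z * rf_eval t z"
proof -
  let ?n = "\<lambda>r. fst (quot_of_fract r)" and ?d = "\<lambda>r. snd (quot_of_fract r)"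
  have "(r * t) * to_fract (?d r * ?d t) = (r * to_fract (?d r)) * (t * to_fract (?d t))"
    by (simp add: algebra_simps)
  also have "\<dots> = to_fract (?n r * ?n t)" unfolding rf_times_snd by simp
  finally have *: "(r * t) * to_fract (?d r * ?d t) = to_fract (?n r * ?n t)" .
  have nz: "poly (?d r * ?d t) z \<noteq> 0" using assms by (simp add: rf_pole_def)
  show "\<not> rf_pole (r * t) z" "rf_eval (r * t) z = rf_eval r z * rf_eval t z"
    using rf_eval_quotient[OF * nz] nz by (simp_all add: rf_eval_def)
qed

lemma rf_eval_sum:
  assumes "finite A" "\<And>k. k \<in> A \<Longrightarrow> \<not> rf_pole (g k) z"
  shows "\<not> rf_pole (\<Sum>k\<in>A. g k) z \<and> rf_eval (\<Sum>k\<in>A. g k) z = (\<Sum>k\<in>A. rf_eval (g k) z)"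
  using assms
proof (induction A rule: finite_induct)
  case empty
  then show ?case using rf_eval_to_fract[of 0 z] by simp
next
  case (insert k A)
  then show ?case by (simp add: rf_eval_add)
qed

lemma eventually_not_rf_pole: "eventually (\<lambda>z. \<not> rf_pole r z) at_infinity"
proof -
  define S where "S = {z. poly (snd (quot_of_fract r)) z = 0}"
  have "finite S" unfolding S_def by (rule poly_roots_finite) simp
  then obtain B where B: "\<forall>z\<in>S. norm z \<le> B" using finite_imp_bounded bounded_iff by metis
  show ?thesis
    unfolding eventually_at_infinity
  proof (intro exI[of _ "B + 1"] allI impI)
    fix z :: complex assume "norm z \<ge> B + 1"
    then have "z \<notin> S" using B by fastforce
    then show "\<not> rf_pole r z" by (simp add: S_def rf_pole_def)
  qed
qed

text \<open>The variable is \<open>w = 1/z\<close>, so index \<open>n\<close> belongs to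
  \<open>z^(-n)\<close>, one more than the index of \<open>laurent_coeff\<close>.\<close>

definition rf_laurent :: "ratfun \<Rightarrow> complex fls" where
  "rf_laurent r = laurent_expansion (\<lambda>w. rf_eval r (inverse w)) 0"

lemma has_rf_laurent: "(\<lambda>w. rf_eval r (inverse w)) has_laurent_expansion rf_laurent r"
  unfolding rf_laurent_def by (rule rf_eval_inverse_has_laurent_expansion)

lemma rf_laurent_eqI:
  assumes "eventually (\<lambda>z. rf_eval r z = g z) at_infinity"
    and "(\<lambda>w. g (inverse w)) has_laurent_expansion G"
  shows "rf_laurent r = G"
proof -
  have "eventually (\<lambda>w. rf_eval r (inverse w) = g (inverse w)) (at 0)"
    using assms(1) by (simp add: at_to_infinity eventually_filtermap)
  then have "(\<lambda>w. rf_eval r (inverse w)) has_laurent_expansion G"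
    using assms(2) has_laurent_expansion_cong[OF _ refl] by simp
  then show ?thesis using has_rf_laurent has_laurent_expansion_unique by blast
qed

lemma rf_laurent_sum:
  assumes "finite A"
  shows "rf_laurent (\<Sum>k\<in>A. g k) = (\<Sum>k\<in>A. rf_laurent (g k))"
proof (rule rf_laurent_eqI[where g = "\<lambda>z. \<Sum>k\<in>A. rf_eval (g k) z"])
  have "eventually (\<lambda>z. \<forall>k\<in>A. \<not> rf_pole (g k) z) at_infinity"
    using assms eventually_not_rf_pole by (simp add: eventually_ball_finite_distrib)
  then show "eventually (\<lambda>z. rf_eval (\<Sum>k\<in>A. g k) z = (\<Sum>k\<in>A. rf_eval (g k) z)) at_infinity"
    by eventually_elim (use rf_eval_sum assms in blast)
  show "(\<lambda>w. \<Sum>k\<in>A. rf_eval (g k) (inverse w)) has_laurent_expansion (\<Sum>k\<in>A. rf_laurent (g k))"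
    by (intro laurent_expansion_intros has_rf_laurent)
qed

lemma rf_laurent_mult_poly:
  assumes "\<And>l. l \<ge> N \<Longrightarrow> coeff p l = 0"
  shows "fls_nth (rf_laurent (r * to_fract p)) n = (\<Sum>l<N. coeff p l * fls_nth (rf_laurent r) (n + int l))"
proof -
  define G where "G = (\<Sum>l<N. fls_const (coeff p l) * (fls_X_intpow (- int l) * rf_laurent r))"
  have "rf_laurent (r * to_fract p) = G"
  proof (rule rf_laurent_eqI[where g = "\<lambda>z. \<Sum>l<N. coeff p l * (inverse z powi (- int l) * rf_eval r z)"])
    have *: "poly p z = (\<Sum>l<N. coeff p l * z ^ l)" for z
    proof -
      have "poly p z = (\<Sum>l\<le>degree p. coeff p l * z ^ l)" by (rule poly_altdef)
      also have "\<dots> = (\<Sum>l<N + Suc (degree p). coeff p l * z ^ l)"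
        by (rule sum.mono_neutral_left) (auto simp: coeff_eq_0)
      also have "\<dots> = (\<Sum>l<N. coeff p l * z ^ l)"
        by (rule sum.mono_neutral_right) (auto simp: assms)
      finally show ?thesis .
    qed
    show "eventually (\<lambda>z. rf_eval (r * to_fract p) z
        = (\<Sum>l<N. coeff p l * (inverse z powi (- int l) * rf_eval r z))) at_infinity"
      using eventually_not_rf_pole[of r]
    proof eventually_elim
      case (elim z)
      have "rf_eval (r * to_fract p) z = rf_eval r z * poly p z"
        using rf_eval_mult(2)[OF elim rf_eval_to_fract(1)] by (simp add: rf_eval_to_fract)
      then show ?case
        by (simp add: * sum_distrib_left power_int_minus power_inverse mult_ac)
    qed
    show "(\<lambda>w. \<Sum>l<N. coeff p l * (inverse (inverse w) powi (- int l) * rf_eval r (inverse w)))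
        has_laurent_expansion G"
      unfolding G_def inverse_inverse_eq by (intro laurent_expansion_intros has_rf_laurent)
  qed
  then show ?thesis
    unfolding G_def fls_X_intpow_times_conv_shift by (simp add: fls_nth_sum)
qed

lemma rf_laurent_poly:
  "fls_nth (rf_laurent (to_fract p)) n = (if n \<le> 0 then coeff p (nat (- n)) else 0)"
proof -
  have one: "rf_laurent 1 = 1"
    by (rule rf_laurent_eqI[where g = "\<lambda>_. 1"]) (use rf_eval_to_fract[of 1] in auto)
  have "fls_nth (rf_laurent (1 * to_fract p)) n
      = (\<Sum>l<Suc (degree p). coeff p l * fls_nth (rf_laurent 1) (n + int l))"
    by (rule rf_laurent_mult_poly) (simp add: coeff_eq_0)
  also have "\<dots> = (\<Sum>l<Suc (degree p). if n = - int l then coeff p l else 0)"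
    unfolding one by (intro sum.cong) auto
  also have "\<dots> = (if n \<le> 0 then coeff p (nat (- n)) else 0)"
  proof (cases "n \<le> 0")
    case True
    then obtain k where "n = - int k" by (metis nonpos_int_cases)
    then show ?thesis by (auto simp: coeff_eq_0)
  qed (auto intro!: sum.neutral)
  finally show ?thesis by simp
qed

section \<open>Laurent coefficients and limits of rational matrix functions\<close>

lemma coeff_entry: "coeff (map_poly (\<lambda>A. A $ i $ j) P) k = coeff P k $ i $ j"
  for P :: "(complex^'n^'n) poly"
  by (simp add: coeff_map_poly)

lemma laurent_coeff_nth: "laurent_coeff R j $ i $ k = fls_nth (rf_laurent (R $ i $ k)) (j + 1)"
  by (simp add: laurent_coeff_def rf_laurent_def)

text \<open>Comparison of the coefficients of \<open>z^b\<close> in \<open>W P = Q\<close>: index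
  \<open>l - b - 1\<close> belongs to the power \<open>z^(b-l)\<close>, which meets
  \<open>coeff P l\<close>.\<close>

lemma laurent_coeff_quotient:
  fixes P Q :: "(complex^'n^'n) poly"
  assumes W: "W ** rat_matrix P = rat_matrix Q" and N: "\<And>l. l \<ge> N \<Longrightarrow> coeff P l = 0"
  shows "(\<Sum>l<N. laurent_coeff W (int l - b - 1) *v (coeff P l *v v))
      = (if b < 0 then 0 else coeff Q (nat b) *v v)"
proof -
  have "(\<Sum>l<N. laurent_coeff W (int l - b - 1) ** coeff P l) = (if b < 0 then 0 else coeff Q (nat b))"
    unfolding vec_eq_iff
  proof (intro allI)
    fix i j
    have "(\<Sum>l<N. laurent_coeff W (int l - b - 1) ** coeff P l) $ i $ j
        = (\<Sum>l<N. \<Sum>k\<in>UNIV. fls_nth (rf_laurent (W $ i $ k)) (int l - b) * coeff P l $ k $ j)"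
      by (simp add: matrix_matrix_mult_def laurent_coeff_nth sum_component)
    also have "\<dots> = (\<Sum>k\<in>UNIV. \<Sum>l<N. coeff P l $ k $ j * fls_nth (rf_laurent (W $ i $ k)) (- b + int l))"
      by (subst sum.swap) (simp add: mult.commute)
    also have "\<dots> = (\<Sum>k\<in>UNIV. fls_nth (rf_laurent (W $ i $ k * rat_matrix P $ k $ j)) (- b))"
      by (intro sum.cong refl)
         (simp add: rat_matrix_def rf_laurent_mult_poly[where N = N] coeff_entry N)
    also have "\<dots> = fls_nth (rf_laurent ((W ** rat_matrix P) $ i $ j)) (- b)"
      by (simp add: matrix_matrix_mult_def rf_laurent_sum fls_nth_sum)
    also have "\<dots> = (if b < 0 then 0 else coeff Q (nat b)) $ i $ j"
      unfolding W by (simp add: rat_matrix_def rf_laurent_poly coeff_entry)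
    finally show "(\<Sum>l<N. laurent_coeff W (int l - b - 1) ** coeff P l) $ i $ j
        = (if b < 0 then 0 else coeff Q (nat b)) $ i $ j" .
  qed
  from arg_cong[OF this, of "\<lambda>M. M *v v"]
  have "(\<Sum>l<N. laurent_coeff W (int l - b - 1) ** coeff P l) *v v
      = (if b < 0 then 0 else coeff Q (nat b) *v v)" by simp
  moreover have "(\<Sum>l<N. M l) *v v = (\<Sum>l<N. M l *v v)" for M :: "nat \<Rightarrow> complex^'n^'n"
    by (induction N) (simp_all add: matrix_vector_mult_add_rdistrib)
  ultimately show ?thesis by (simp add: matrix_vector_mul_assoc)
qed

lemma laurent_coeff_bounded: "\<exists>J. \<forall>j<J. laurent_coeff R j = 0"
proof -
  define d where "d = (\<lambda>(i, k). fls_subdegree (rf_laurent (R $ i $ k)))"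
  define J where "J = Min (range d) - 1"
  have "laurent_coeff R j = 0" if "j < J" for j
  proof -
    have "fls_nth (rf_laurent (R $ i $ k)) (j + 1) = 0" for i k
    proof (rule fls_eq0_below_subdegree)
      have "Min (range d) \<le> d (i, k)" by (intro Min_le) auto
      then show "j + 1 < fls_subdegree (rf_laurent (R $ i $ k))" using that by (simp add: J_def d_def)
    qed
    then show ?thesis by (simp add: vec_eq_iff laurent_coeff_nth)
  qed
  then show ?thesis by blast
qed

lemma laurent_coeff_R_tilde_z: "laurent_coeff (R_tilde_z F) j = - laurent_coeff (R_tilde F) (j - 1)"
proof -
  have "fls_nth (rf_laurent (R_tilde_z F $ i $ k)) (j + 1) = - fls_nth (rf_laurent (R_tilde F $ i $ k)) j" for i k
  proof -
    \<comment> \<open>Division by \<open>-z\<close> is read backwards as multiplication by a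
      polynomial, to which \<open>rf_laurent_mult_poly\<close> applies.\<close>
    have "R_tilde F $ i $ k = R_tilde_z F $ i $ k * to_fract [:0, -1:]"
    proof -
      have "rf_var \<noteq> 0" by simp
      moreover have "to_fract [:0, -1:] = - rf_var" by (simp flip: to_fract_uminus)
      ultimately show ?thesis by (simp add: R_tilde_z_def)
    qed
    then have "fls_nth (rf_laurent (R_tilde F $ i $ k)) j
        = fls_nth (rf_laurent (R_tilde_z F $ i $ k * to_fract [:0, -1:])) j" by simp
    also have "\<dots> = (\<Sum>l<2. coeff [:0, -1:] l * fls_nth (rf_laurent (R_tilde_z F $ i $ k)) (j + int l))"
      by (rule rf_laurent_mult_poly) (auto simp: coeff_eq_0)
    finally show ?thesis by (simp add: numeral_2_eq_2)
  qed
  then show ?thesis by (simp add: vec_eq_iff laurent_coeff_nth)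
qed

text \<open>In \<open>w = 1/z\<close> each entry is either analytic at 0 after filling in its
  constant term, or has a pole and tends to infinity. Index -1 is the coefficient of
  \<open>z^0\<close>.\<close>

lemma rm_eval_tendsto_iff:
  "(rm_eval R \<longlongrightarrow> L) at_infinity \<longleftrightarrow> (\<forall>j < -1. laurent_coeff R j = 0) \<and> L = laurent_coeff R (-1)"
proof -
  have entry: "(rf_eval r \<longlongrightarrow> l) at_infinity \<longleftrightarrow> (\<forall>n<0. fls_nth (rf_laurent r) n = 0) \<and> l = fls_nth (rf_laurent r) 0"
    for r l
  proof -
    have lim: "(rf_eval r \<longlongrightarrow> l) at_infinity \<longleftrightarrow> ((\<lambda>w. rf_eval r (inverse w)) \<longlongrightarrow> l) (at 0)"
      by (simp add: at_to_infinity filterlim_filtermap)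
    show ?thesis
    proof (cases "fls_subdegree (rf_laurent r) \<ge> 0")
      case True
      then have "((\<lambda>w. rf_eval r (inverse w)) \<longlongrightarrow> fls_nth (rf_laurent r) 0) (at 0)"
        by (intro has_laurent_expansion_imp_tendsto_0 has_rf_laurent)
      moreover have "\<forall>n<0. fls_nth (rf_laurent r) n = 0" using True by auto
      ultimately show ?thesis unfolding lim using tendsto_unique[OF at_neq_bot] by blast
    next
      case False
      then have "filterlim (\<lambda>w. rf_eval r (inverse w)) at_infinity (at 0)"
        by (intro has_laurent_expansion_imp_filterlim_infinity_0[OF has_rf_laurent]) simp
      then have "\<not> ((\<lambda>w. rf_eval r (inverse w)) \<longlongrightarrow> l) (at 0)"
        using not_tendsto_and_filterlim_at_infinity[OF at_neq_bot] by blast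
      moreover have "rf_laurent r \<noteq> 0" using False by auto
      then have "\<not> (\<forall>n<0. fls_nth (rf_laurent r) n = 0)"
        using False fls_subdegree_geI[of "rf_laurent r" 0] by auto
      ultimately show ?thesis unfolding lim by blast
    qed
  qed
  have "(rm_eval R \<longlongrightarrow> L) at_infinity \<longleftrightarrow> (\<forall>i k. (rf_eval (R $ i $ k) \<longlongrightarrow> L $ i $ k) at_infinity)"
  proof
    assume "(rm_eval R \<longlongrightarrow> L) at_infinity"
    then have "((\<lambda>z. rm_eval R z $ i $ k) \<longlongrightarrow> L $ i $ k) at_infinity" for i k
      by (intro tendsto_vec_nth)
    then show "\<forall>i k. (rf_eval (R $ i $ k) \<longlongrightarrow> L $ i $ k) at_infinity" by (simp add: rm_eval_def)
  next
    assume "\<forall>i k. (rf_eval (R $ i $ k) \<longlongrightarrow> L $ i $ k) at_infinity"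
    then show "(rm_eval R \<longlongrightarrow> L) at_infinity"
      by (intro vec_tendstoI) (simp add: rm_eval_def)
  qed
  also have "\<dots> \<longleftrightarrow> (\<forall>j < -1. laurent_coeff R j = 0) \<and> L = laurent_coeff R (-1)"
  proof -
    have "(\<forall>j < -1. laurent_coeff R j = 0) \<longleftrightarrow> (\<forall>i k. \<forall>n<0. fls_nth (rf_laurent (R $ i $ k)) n = 0)"
    proof
      assume *: "\<forall>j < -1. laurent_coeff R j = 0"
      show "\<forall>i k. \<forall>n<0. fls_nth (rf_laurent (R $ i $ k)) n = 0"
      proof (intro allI impI)
        fix i k and n :: int assume "n < 0"
        then have "laurent_coeff R (n - 1) = 0" using * by simp
        then show "fls_nth (rf_laurent (R $ i $ k)) n = 0"
          using laurent_coeff_nth[of R "n - 1" i k] by simp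
      qed
    qed (simp add: vec_eq_iff laurent_coeff_nth)
    then show ?thesis unfolding entry by (auto simp: vec_eq_iff laurent_coeff_nth)
  qed
  finally show ?thesis .
qed

section \<open>Determinants, regularity and inverses\<close>

lemma det_hom:
  fixes M :: "'a::comm_ring_1^'n^'n" and h :: "'a \<Rightarrow> 'b::comm_ring_1"
  assumes h: "h 1 = 1" "\<And>x y. h (x + y) = h x + h y" "\<And>x y. h (x * y) = h x * h y"
  shows "h (det M) = det (map_matrix h M)"
proof -
  have h0: "h 0 = 0" using h(2)[of 0 0] by simp
  have neg: "h (- x) = - h x" for x using h(2)[of x "- x"] h0 by (simp add: eq_neg_iff_add_eq_0 add.commute)
  have sum: "h (\<Sum>i\<in>A. g i) = (\<Sum>i\<in>A. h (g i))" for g :: "'c \<Rightarrow> 'a" and A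
    by (induction A rule: infinite_finite_induct) (simp_all add: h0 h)
  have prod: "h (\<Prod>i\<in>A. g i) = (\<Prod>i\<in>A. h (g i))" for g :: "'c \<Rightarrow> 'a" and A
    by (induction A rule: infinite_finite_induct) (simp_all add: h)
  show ?thesis
    unfolding det_def sum
    by (intro sum.cong refl) (auto simp: h prod neg sign_def)
qed

lemma mp_eval_entry: "mp_eval P z $ i $ j = poly (map_poly (\<lambda>A. A $ i $ j) P) z"
proof -
  have "degree (map_poly (\<lambda>A. A $ i $ j) P) \<le> degree P" by (rule map_poly_degree_leq)
  then have "poly (map_poly (\<lambda>A. A $ i $ j) P) z = (\<Sum>k\<le>degree P. coeff P k $ i $ j * z ^ k)"
    unfolding poly_altdef using le_degree[of "map_poly (\<lambda>A. A $ i $ j) P"]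
    by (intro sum.mono_neutral_cong_left) (auto simp: coeff_entry)
  then show ?thesis by (simp add: mp_eval_def mult.commute)
qed

text \<open>The determinant over the polynomial ring is nonzero at one point, hence nonzero as a
  polynomial and in the fraction field.\<close>

lemma invertible_rat_matrix:
  fixes P :: "(complex^'n^'n) poly"
  assumes "mp_regular P"
  shows "invertible (rat_matrix P)"
proof -
  obtain z where z: "det (mp_eval P z) \<noteq> 0" using assms by (auto simp: mp_regular_def)
  define M :: "complex poly^'n^'n" where "M = (\<chi> i j. map_poly (\<lambda>A. A $ i $ j) P)"
  have "mp_eval P z = map_matrix (\<lambda>p. poly p z) M" by (simp add: vec_eq_iff mp_eval_entry M_def)
  then have "poly (det M) z = det (mp_eval P z)" using det_hom[of "\<lambda>p. poly p z" M] by simp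
  then have "det M \<noteq> 0" using z by auto
  moreover have "rat_matrix P = map_matrix to_fract M" by (simp add: vec_eq_iff rat_matrix_def M_def)
  then have "det (rat_matrix P) = to_fract (det M)" using det_hom[of to_fract M] by simp
  ultimately show ?thesis by (simp add: invertible_det_nz)
qed

lemma matrix_inv_mult_left:
  assumes "invertible A"
  shows "(B ** matrix_inv A) ** A = B"
proof -
  have "matrix_inv A ** A = mat 1"
    using someI_ex[OF assms[unfolded invertible_def]] by (simp add: matrix_inv_def)
  then show ?thesis by (simp add: matrix_mul_assoc[symmetric])
qed

lemma mp_eval_vec:
  fixes P :: "(complex^'n^'n) poly"
  assumes "degree P \<le> N"
  shows "mp_eval P z *v v = (\<Sum>k\<le>N. z ^ k *s (coeff P k *v v))"
proof -
  have scale: "map_matrix ((*) c) A *v v = c *s (A *v v)" for c and A :: "complex^'n^'n"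
    by (simp add: vec_eq_iff matrix_vector_mult_def sum_distrib_left mult.assoc)
  have sum: "(\<Sum>k\<in>S. M k) *v v = (\<Sum>k\<in>S. M k *v v)" for M :: "nat \<Rightarrow> complex^'n^'n" and S
    by (induction S rule: infinite_finite_induct) (simp_all add: matrix_vector_mult_add_rdistrib)
  show ?thesis
    unfolding mp_eval_conv_sum[OF \<open>degree P \<le> N\<close>] sum scale ..
qed

text \<open>The reversed polynomial \<open>w^m P(1/w)\<close> has value \<open>mat 1\<close> at 0.
  If \<open>P\<close> were singular everywhere, its determinant would have infinitely many roots
  without being zero.\<close>

lemma mp_regular_if_monic:
  fixes P :: "(complex^'n^'n) poly"
  assumes "mp_monic P"
  shows "mp_regular P"
proof (rule ccontr)
  assume "\<not> mp_regular P"
  then have sing: "det (mp_eval P z) = 0" for z by (simp add: mp_regular_def)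
  define m where "m = degree P"
  define M :: "complex poly^'n^'n" where "M = (\<chi> i j. \<Sum>k\<le>m. monom (coeff P k $ i $ j) (m - k))"
  have M: "map_matrix (\<lambda>p. poly p w) M = (\<Sum>k\<le>m. map_matrix ((*) (w ^ (m - k))) (coeff P k))" for w
    by (simp add: vec_eq_iff M_def poly_sum poly_monom mult.commute)
  have det: "poly (det M) w = det (map_matrix (\<lambda>p. poly p w) M)" for w
    using det_hom[of "\<lambda>p. poly p w" M] by simp
  have "map_matrix (\<lambda>p. poly p 0) M = (\<Sum>k\<le>m. if k = m then coeff P k else 0)"
    unfolding M by (rule sum.cong) (auto simp: vec_eq_iff power_0_left)
  then have "map_matrix (\<lambda>p. poly p 0) M = mat 1"
    using assms by (simp add: mp_monic_def m_def)
  then have "poly (det M) 0 = 1" by (simp add: det)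
  moreover have "poly (det M) w = 0" if w: "w \<noteq> 0" for w
  proof -
    have "map_matrix (\<lambda>p. poly p w) M = map_matrix ((*) (w ^ m)) (mp_eval P (inverse w))"
      unfolding M mp_eval_def vec_eq_iff m_def[symmetric]
      using w by (auto simp: sum_distrib_left mult.assoc[symmetric] power_diff power_inverse divide_inverse
          intro!: sum.cong)
    also have "\<dots> = mat (w ^ m) ** mp_eval P (inverse w)"
      by (simp add: vec_eq_iff matrix_matrix_mult_def mat_def if_distrib[of "\<lambda>x. x * _"] cong: if_cong)
    finally show ?thesis by (simp add: det det_mul sing)
  qed
  then have "{w. poly (det M) w = 0} \<supseteq> - {0}" by auto
  ultimately have "infinite {w. poly (det M) w = 0}" "det M \<noteq> 0"
    using infinite_super[of "- {0 :: complex}"] by (auto simp: infinite_UNIV_char_0)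
  then show False using poly_roots_finite by blast
qed

section \<open>Self-adjointness as an identity between coefficients\<close>

lemma poly_map_poly_mult_vec:
  "cnj (poly (map_poly (\<lambda>A. cnj ((A *v u) $ r)) P) (of_real x)) = (mp_eval P (of_real x) *v u) $ r"
  "poly (map_poly (\<lambda>A. (A *v u) $ r) P) z = (mp_eval P z *v u) $ r"
  for P :: "(complex^'n^'n) poly"
proof -
  have *: "poly (map_poly g P) z = (\<Sum>k\<le>degree P. g (coeff P k) * z ^ k)"
    if "g 0 = 0" for g :: "complex^'n^'n \<Rightarrow> complex" and z
    unfolding poly_altdef using map_poly_degree_leq[of g P] that
    using le_degree[of "map_poly g P"]
    by (intro sum.mono_neutral_cong_left) (auto simp: coeff_map_poly)
  show "cnj (poly (map_poly (\<lambda>A. cnj ((A *v u) $ r)) P) (of_real x)) = (mp_eval P (of_real x) *v u) $ r"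
    "poly (map_poly (\<lambda>A. (A *v u) $ r) P) z = (mp_eval P z *v u) $ r"
    by (simp_all add: * mp_eval_vec[OF order_refl] mult.commute)
qed

lemma herm_inner_matrix_adjoint: "herm_inner (A *v u) v = herm_inner u (map_matrix cnj (transpose A) *v v)"
proof -
  have "herm_inner (A *v u) v = (\<Sum>i\<in>UNIV. \<Sum>j\<in>UNIV. cnj (u $ j) * (cnj (A $ i $ j) * v $ i))"
    by (simp add: herm_inner_def matrix_vector_mult_def sum_distrib_right sum_distrib_left mult_ac)
  also have "\<dots> = (\<Sum>j\<in>UNIV. \<Sum>i\<in>UNIV. cnj (u $ j) * (cnj (A $ i $ j) * v $ i))"
    by (rule sum.swap)
  also have "\<dots> = herm_inner u (map_matrix cnj (transpose A) *v v)"
    by (simp add: herm_inner_def matrix_vector_mult_def transpose_def sum_distrib_left)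
  finally show ?thesis .
qed

text \<open>At a large real \<open>x\<close>, which conjugation fixes and which is not a pole,
  \<open>R(x)\<close> is Hermitian; hence \<open>Q(x)^* P(x) = P(x)^* Q(x)\<close>. Infinitely many
  such points make this a polynomial identity.\<close>

lemma self_adjoint_quotient:
  fixes P Q :: "(complex^'n^'n) poly"
  assumes sa: "self_adjoint R" and R: "R ** rat_matrix P = - rat_matrix Q"
  shows "(\<Sum>i\<le>c. herm_inner (coeff Q i *v u) (coeff P (c - i) *v v))
       = (\<Sum>i\<le>c. herm_inner (coeff P i *v u) (coeff Q (c - i) *v v))"
proof -
  define pl where "pl = (\<lambda>(P :: (complex^'n^'n) poly) u r. map_poly (\<lambda>A. cnj ((A *v u) $ r)) P)"
  define pr where "pr = (\<lambda>(P :: (complex^'n^'n) poly) u r. map_poly (\<lambda>A. (A *v u) $ r) P)"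
  \<comment> \<open>At a real point \<open>x\<close> this polynomial has as its value the inner
    product of \<open>P(x) u\<close> and \<open>Q(x) v\<close>.\<close>
  define h where "h = (\<lambda>P Q. \<Sum>r\<in>UNIV. pl P u r * pr Q v r)"
  have coeff_h: "coeff (h P Q) c = (\<Sum>i\<le>c. herm_inner (coeff P i *v u) (coeff Q (c - i) *v v))" for P Q
    unfolding h_def coeff_sum coeff_mult herm_inner_def
    by (subst sum.swap) (simp add: pl_def pr_def coeff_map_poly)
  have poly_h: "poly (h P Q) (of_real x) = herm_inner (mp_eval P (of_real x) *v u) (mp_eval Q (of_real x) *v v)" for P Q x
    unfolding h_def poly_sum herm_inner_def
    by (simp add: pl_def pr_def poly_map_poly_mult_vec(2) flip: poly_map_poly_mult_vec(1))
  have "eventually (\<lambda>z. \<forall>i k. \<not> rf_pole (R $ i $ k) z) at_infinity"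
    by (simp add: eventually_all_finite eventually_not_rf_pole)
  then obtain B where B: "\<And>z i k. norm z \<ge> B \<Longrightarrow> \<not> rf_pole (R $ i $ k) z"
    by (auto simp: eventually_at_infinity)
  have eq: "poly (h Q P - h P Q) (of_real x) = 0" if x: "x \<ge> B" for x :: real
  proof -
    let ?x = "complex_of_real x"
    have np: "\<not> rf_pole (R $ i $ k) ?x" for i k using B[of ?x] x by simp
    have "rm_eval R ?x ** mp_eval P ?x = - mp_eval Q ?x"
      unfolding vec_eq_iff
    proof (intro allI)
      fix i j
      have "(rm_eval R ?x ** mp_eval P ?x) $ i $ j
          = (\<Sum>k\<in>UNIV. rf_eval (R $ i $ k) ?x * rf_eval (rat_matrix P $ k $ j) ?x)"
        by (simp add: matrix_matrix_mult_def rm_eval_def rat_matrix_def rf_eval_to_fract mp_eval_entry)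
      also have "\<dots> = (\<Sum>k\<in>UNIV. rf_eval (R $ i $ k * rat_matrix P $ k $ j) ?x)"
        by (intro sum.cong refl rf_eval_mult(2)[symmetric] np) (simp add: rat_matrix_def rf_eval_to_fract)
      also have "\<dots> = rf_eval (\<Sum>k\<in>UNIV. R $ i $ k * rat_matrix P $ k $ j) ?x"
        by (subst rf_eval_sum[THEN conjunct2]) (auto simp: rat_matrix_def rf_eval_to_fract np rf_eval_mult)
      also have "\<dots> = rf_eval (- rat_matrix Q $ i $ j) ?x"
        using R by (simp add: vec_eq_iff matrix_matrix_mult_def)
      also have "\<dots> = - mp_eval Q ?x $ i $ j"
        by (simp add: rat_matrix_def mp_eval_entry rf_eval_to_fract flip: to_fract_uminus)
      finally show "(rm_eval R ?x ** mp_eval P ?x) $ i $ j = (- mp_eval Q ?x) $ i $ j" by simp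
    qed
    then have RP: "mp_eval Q ?x *v w = - (rm_eval R ?x *v (mp_eval P ?x *v w))" for w
      by (simp add: matrix_vector_mul_assoc) (simp add: matrix_vector_mult_def vec_eq_iff sum_negf)
    have "rm_eval R ?x = map_matrix cnj (transpose (rm_eval R ?x))"
      using sa np unfolding self_adjoint_def by (metis complex_cnj_complex_of_real)
    then have "herm_inner (rm_eval R ?x *v y) w = herm_inner y (rm_eval R ?x *v w)" for y w
      by (metis herm_inner_matrix_adjoint)
    then show ?thesis by (simp add: poly_h RP herm_inner_minus)
  qed
  have "infinite (of_real ` {B..} :: complex set)"
    by (subst finite_image_iff) (auto simp: inj_on_def infinite_Ici)
  moreover have "of_real ` {B..} \<subseteq> {z. poly (h Q P - h P Q) z = 0}" using eq by auto
  ultimately have "infinite {z. poly (h Q P - h P Q) z = 0}" using finite_subset by blast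
  then have "h Q P - h P Q = 0" using poly_roots_finite by blast
  then have "coeff (h Q P) c = coeff (h P Q) c" by simp
  then show ?thesis by (simp only: coeff_h)
qed

section \<open>The stability criterion\<close>

lemma selfadjoint_entry:
  fixes M :: "complex^'n^'n"
  assumes "\<And>u v. herm_inner (M *v u) v = herm_inner u (M *v v)"
  shows "M $ i $ j = cnj (M $ j $ i)"
proof -
  have herm_inner_axis: "herm_inner (axis i 1) w = w $ i" for i and w :: "complex^'n"
    by (simp add: herm_inner_def axis_def if_distrib[of cnj] if_distrib[of "\<lambda>c. c * _"] cong: if_cong)
  have "(M *v axis j 1) $ i = M $ i $ j" for i j
    by (simp add: matrix_vector_mult_def axis_def if_distrib[of "\<lambda>c. _ * c"] cong: if_cong)
  then have h: "herm_inner (axis i 1) (M *v axis j 1) = M $ i $ j" for i j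
    by (simp add: herm_inner_axis)
  show ?thesis
    using assms[of "axis i 1" "axis j 1"] herm_inner_commute[of "M *v axis i 1" "axis j 1"] by (simp add: h)
qed

text \<open>Self-adjoint blocks depending only on \<open>a + b\<close> supply the Hermitian half of
  the definition; the other half regroups the scalar sum by blocks.\<close>

lemma negative_definite_iff:
  fixes T :: "nat \<Rightarrow> complex^'n^'n"
  assumes T: "\<And>j u v. herm_inner (T j *v u) v = herm_inner u (T j *v v)"
  shows "negative_definite ({..n} \<times> UNIV) (\<lambda>(a, i) (b, j). T (a + b) $ i $ j) \<longleftrightarrow>
    (\<forall>y. (\<exists>c<Suc n. y c \<noteq> 0) \<longrightarrow> Re (\<Sum>c<Suc n. \<Sum>d<Suc n. herm_inner (y c) (T (c + d) *v y d)) < 0)"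
proof -
  note herm = selfadjoint_entry[OF T]
  have form: "(\<Sum>p\<in>{..n} \<times> UNIV. \<Sum>q\<in>{..n} \<times> UNIV.
        cnj (x p) * (\<lambda>(a, i) (b, j). T (a + b) $ i $ j) p q * x q)
      = (\<Sum>c<Suc n. \<Sum>d<Suc n. herm_inner (\<chi> i. x (c, i)) (T (c + d) *v (\<chi> i. x (d, i))))" for x
  proof -
    have "(\<Sum>p\<in>{..n} \<times> UNIV. \<Sum>q\<in>{..n} \<times> UNIV.
        cnj (x p) * (\<lambda>(a, i) (b, j). T (a + b) $ i $ j) p q * x q)
      = (\<Sum>a\<le>n. \<Sum>i\<in>UNIV. \<Sum>b\<le>n. \<Sum>j\<in>UNIV. cnj (x (a, i)) * T (a + b) $ i $ j * x (b, j))"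
      by (simp add: sum.cartesian_product')
    also have "\<dots> = (\<Sum>a\<le>n. \<Sum>b\<le>n. \<Sum>i\<in>UNIV. \<Sum>j\<in>UNIV. cnj (x (a, i)) * T (a + b) $ i $ j * x (b, j))"
      by (intro sum.cong refl sum.swap)
    finally show ?thesis
      by (simp add: herm_inner_def matrix_vector_mult_def sum_distrib_left mult.assoc lessThan_Suc_atMost
          del: sum.lessThan_Suc)
  qed
  show ?thesis
  proof
    assume nd: "negative_definite ({..n} \<times> UNIV) (\<lambda>(a, i) (b, j). T (a + b) $ i $ j)"
    show "\<forall>y. (\<exists>c<Suc n. y c \<noteq> 0) \<longrightarrow> Re (\<Sum>c<Suc n. \<Sum>d<Suc n. herm_inner (y c) (T (c + d) *v y d)) < 0"
    proof (intro allI impI)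
      fix y :: "nat \<Rightarrow> complex^'n" assume "\<exists>c<Suc n. y c \<noteq> 0"
      then obtain c i where "c \<le> n" "y c $ i \<noteq> 0" by (auto simp: vec_eq_iff less_Suc_eq_le)
      then have "\<exists>p\<in>{..n} \<times> UNIV. (\<lambda>(c, i). y c $ i) p \<noteq> 0"
        by (intro bexI[of _ "(c, i)"]) auto
      then have "Re (\<Sum>p\<in>{..n} \<times> UNIV. \<Sum>q\<in>{..n} \<times> UNIV.
        cnj ((\<lambda>(c, i). y c $ i) p) * (\<lambda>(a, i) (b, j). T (a + b) $ i $ j) p q * (\<lambda>(c, i). y c $ i) q) < 0"
        by (rule nd[unfolded negative_definite_def, THEN conjunct2, rule_format])
      then show "Re (\<Sum>c<Suc n. \<Sum>d<Suc n. herm_inner (y c) (T (c + d) *v y d)) < 0"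
        unfolding form by simp
    qed
  next
    assume *: "\<forall>y. (\<exists>c<Suc n. y c \<noteq> 0) \<longrightarrow> Re (\<Sum>c<Suc n. \<Sum>d<Suc n. herm_inner (y c) (T (c + d) *v y d)) < 0"
    show "negative_definite ({..n} \<times> UNIV) (\<lambda>(a, i) (b, j). T (a + b) $ i $ j)"
      unfolding negative_definite_def form
    proof (intro conjI allI impI)
      show "\<forall>p\<in>{..n} \<times> UNIV. \<forall>q\<in>{..n} \<times> UNIV. (\<lambda>(a, i) (b, j). T (a + b) $ i $ j) p q
          = cnj ((\<lambda>(a, i) (b, j). T (a + b) $ i $ j) q p)"
      proof (intro ballI)
        fix p q :: "nat \<times> 'n"
        show "(\<lambda>(a, i) (b, j). T (a + b) $ i $ j) p q = cnj ((\<lambda>(a, i) (b, j). T (a + b) $ i $ j) q p)"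
          using herm[of "fst p + fst q" "snd p" "snd q"] by (simp only: case_prod_unfold add.commute)
      qed
    next
      fix x :: "nat \<times> 'n \<Rightarrow> complex" assume "\<exists>p\<in>{..n} \<times> UNIV. x p \<noteq> 0"
      then obtain c i where "c \<le> n" "x (c, i) \<noteq> 0" by auto
      then have "\<exists>c<Suc n. (\<chi> i. x (c, i)) \<noteq> 0"
        by (intro exI[of _ c]) (auto simp: vec_eq_iff less_Suc_eq_le)
      then show "Re (\<Sum>c<Suc n. \<Sum>d<Suc n. herm_inner (\<chi> i. x (c, i)) (T (c + d) *v (\<chi> i. x (d, i)))) < 0"
        by (rule *[rule_format])
    qed
  qed
qed

lemma negative_definite_matrix_iff:
  fixes M :: "complex^'n^'n"
  assumes M: "\<And>u v. herm_inner (M *v u) v = herm_inner u (M *v v)"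
  shows "negative_definite UNIV (\<lambda>i j. M $ i $ j) \<longleftrightarrow> (\<forall>v. v \<noteq> 0 \<longrightarrow> Re (herm_inner v (M *v v)) < 0)"
proof -
  have form: "(\<Sum>i\<in>UNIV. \<Sum>j\<in>UNIV. cnj (x i) * M $ i $ j * x j) = herm_inner (\<chi> i. x i) (M *v (\<chi> i. x i))" for x
    by (simp add: herm_inner_def matrix_vector_mult_def sum_distrib_left mult.assoc)
  have "(\<forall>x. (\<exists>i\<in>UNIV. x i \<noteq> 0) \<longrightarrow> Re (herm_inner (\<chi> i. x i) (M *v (\<chi> i. x i))) < 0)
      \<longleftrightarrow> (\<forall>v. v \<noteq> 0 \<longrightarrow> Re (herm_inner v (M *v v)) < 0)" (is "?l \<longleftrightarrow> ?r")
  proof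
    assume ?l
    show ?r
    proof (intro allI impI)
      fix v :: "complex^'n" assume "v \<noteq> 0"
      then have "\<exists>i\<in>UNIV. v $ i \<noteq> 0" by (simp add: vec_eq_iff)
      then show "Re (herm_inner v (M *v v)) < 0" using \<open>?l\<close>[rule_format, of "($) v"] by simp
    qed
  qed (auto simp: vec_eq_iff)
  then show ?thesis
    using selfadjoint_entry[OF M] unfolding negative_definite_def form by blast
qed

theorem theorem3p5:
  fixes F :: "(complex^'n^'n) poly" and m :: nat
  assumes "m \<ge> 1"
    and "degree F = 2 * m"
    and "mp_monic F"
    and "self_adjoint (R_F F)"
    and "mp_regular (odd_part F)"
  shows "hurwitz_stable F \<longleftrightarrow>
           (m \<ge> 2 \<longrightarrow> hankel_negative_definite (m - 2) (R_tilde F)) \<and>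
           hankel_negative_definite (m - 1) (R_tilde_z F) \<and>
           (\<exists>L. (rm_eval (R_tilde_z F) \<longlongrightarrow> L) at_infinity \<and>
                negative_definite UNIV (\<lambda>i j. L $ i $ j))"
proof -
  define f where "f = coeff F"
  have f: "f (2 * m) = mat 1" "\<And>k. k > 2 * m \<Longrightarrow> f k = 0"
    using assms(2,3) by (auto simp: f_def mp_monic_def coeff_eq_0)
  have even_monic: "mp_monic (even_part F)"
  proof -
    have "degree (even_part F) = m"
    proof (rule antisym)
      show "degree (even_part F) \<le> m" using f by (intro degree_le) (simp add: coeff_even_part f_def)
      have "F \<noteq> 0" using assms(1,2) by auto
      then show "m \<le> degree (even_part F)" using assms(2) leading_coeff_neq_0[of F]
        by (intro le_degree) (simp add: coeff_even_part)
    qed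
    then show ?thesis using f by (simp add: mp_monic_def coeff_even_part f_def)
  qed
  have odd_high: "coeff (odd_part F) l = 0" if "l \<ge> m" for l
    using f(2) that by (simp add: coeff_odd_part f_def)
  have RF: "R_F F ** rat_matrix (even_part F) = - rat_matrix (odd_part F)"
  proof -
    have "(rat_matrix (odd_part F) ** matrix_inv (rat_matrix (even_part F))) ** rat_matrix (even_part F)
        = rat_matrix (odd_part F)"
      by (intro matrix_inv_mult_left invertible_rat_matrix mp_regular_if_monic even_monic)
    then show ?thesis
      by (simp add: R_F_def) (simp add: matrix_matrix_mult_def vec_eq_iff sum_negf)
  qed
  have RT: "R_tilde F ** rat_matrix (odd_part F) = rat_matrix (even_part F)"
    unfolding R_tilde_def by (intro matrix_inv_mult_left invertible_rat_matrix assms)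
  define s where "s = laurent_coeff (R_tilde F)"
  have quotient: "(\<Sum>k<m. s (int k - b - 1) *v (f (2 * k + 1) *v v))
      = (if b < 0 then 0 else f (2 * nat b) *v v)" for b v
    using laurent_coeff_quotient[OF RT odd_high, where b = b and v = v]
    by (simp add: s_def f_def coeff_even_part coeff_odd_part)
  interpret hermite_fujiwara f "2 * m"
  proof
    show "(\<Sum>i\<le>c. (-1) ^ i * herm_inner (f i *v u) (f (c - i) *v v)) = 0" if "odd c" for c u v
    proof -
      obtain q where c: "c = 2 * q + 1" using \<open>odd c\<close> by (auto elim: oddE)
      have "(\<Sum>i\<le>c. (-1) ^ i * herm_inner (f i *v u) (f (c - i) *v v))
          = (\<Sum>i<2 * Suc q. (-1) ^ i * herm_inner (f i *v u) (f (c - i) *v v))"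
        by (simp add: c lessThan_Suc_atMost[symmetric] del: sum.lessThan_Suc)
      also have "\<dots> = (\<Sum>j<Suc q. herm_inner (f (2 * j) *v u) (f (c - 2 * j) *v v))
          - (\<Sum>j<Suc q. herm_inner (f (2 * j + 1) *v u) (f (c - (2 * j + 1)) *v v))"
        by (subst sum_lessThan_even_odd) (simp add: sum_negf del: sum.lessThan_Suc)
      also have "(\<Sum>j<Suc q. herm_inner (f (2 * j) *v u) (f (c - 2 * j) *v v))
          = (\<Sum>j\<le>q. herm_inner (coeff (even_part F) j *v u) (coeff (odd_part F) (q - j) *v v))"
        unfolding lessThan_Suc_atMost
        by (rule sum.cong) (auto simp: c f_def coeff_even_part coeff_odd_part diff_mult_distrib2 Suc_diff_le)
      also have "(\<Sum>j<Suc q. herm_inner (f (2 * j + 1) *v u) (f (c - (2 * j + 1)) *v v))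
          = (\<Sum>j\<le>q. herm_inner (coeff (odd_part F) j *v u) (coeff (even_part F) (q - j) *v v))"
        unfolding lessThan_Suc_atMost
        by (rule sum.cong) (auto simp: c f_def coeff_even_part coeff_odd_part diff_mult_distrib2)
      finally show ?thesis
        using self_adjoint_quotient[OF assms(4) RF, of u q v] by simp
    qed
  qed (use assms(1) f in auto)
  have seq_apply: "seq_apply z (\<lambda>_. v) = mp_eval F z *v v" for z v
    unfolding seq_apply_def using mp_eval_vec[of F "2 * m" z v] assms(2) by (simp add: f_def)
  have sing: "det (mp_eval F z) = 0 \<longleftrightarrow> (\<exists>v. v \<noteq> 0 \<and> seq_apply z (\<lambda>_. v) = 0)" for z
    unfolding seq_apply using invertible_iff_ker[of "mp_eval F z"] by (auto simp: invertible_det_nz)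
  have hurwitz: "hurwitz_stable F \<longleftrightarrow> positive"
    using positive_if_stable stable_if_positive mp_regular_if_monic[OF assms(3)]
    unfolding hurwitz_stable_def sing by blast
  have lim: "(rm_eval (R_tilde_z F) \<longlongrightarrow> L) at_infinity \<longleftrightarrow> (\<forall>j < -2. s j = 0) \<and> L = - s (-2)" for L
  proof -
    have "(\<forall>j < -1. s (j - 1) = 0) \<longleftrightarrow> (\<forall>j < -2. s j = 0)"
    proof
      assume *: "\<forall>j < -1. s (j - 1) = 0"
      show "\<forall>j < -2. s j = 0"
      proof (intro allI impI)
        fix j :: int assume "j < -2"
        then show "s j = 0" using *[rule_format, of "j + 1"] by simp
      qed
    qed simp
    then show ?thesis
      unfolding rm_eval_tendsto_iff laurent_coeff_R_tilde_z s_def[symmetric] by simp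
  qed
  show ?thesis
  proof (cases "invertible (f (2 * m - 1))")
    case True
    interpret even_odd_quotient f m s
      by unfold_locales (use True quotient laurent_coeff_bounded[of "R_tilde F"] in \<open>auto simp: s_def\<close>)
    have neg: "- M *v v = - (M *v v)" for M :: "complex^'n^'n" and v
      by (simp add: matrix_vector_mult_def vec_eq_iff sum_negf)
    have "hankel_negative_definite (m - 1) (R_tilde_z F)
        \<longleftrightarrow> (\<forall>y. (\<exists>c<m. y c \<noteq> 0) \<longrightarrow> hankel_form m (-1) y > 0)"
    proof -
      have "block_hankel (R_tilde_z F) = (\<lambda>(a, i) (b, j). (- s (int (a + b) - 1)) $ i $ j)"
        by (simp add: block_hankel_def laurent_coeff_R_tilde_z s_def)
      moreover have "Suc (m - 1) = m" using assms(1) by simp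
      moreover have "(\<Sum>c<m. \<Sum>d<m. herm_inner (y c) (- s (int (c + d) - 1) *v y d))
          = - (\<Sum>c<m. \<Sum>d<m. herm_inner (y c) (s (int c + int d + -1) *v y d))" for y
        by (simp add: neg herm_inner_minus sum_negf)
      ultimately show ?thesis
        unfolding hankel_negative_definite_def hankel_form_def
        using negative_definite_iff[of "\<lambda>j. - s (int j - 1)" "m - 1"]
        by (simp add: neg herm_inner_minus s_selfadjoint)
    qed
    \<comment> \<open>For \<open>m = 1\<close> the form has order 0 and admits no nonzero argument,
      which matches the void condition.\<close>
    moreover have "(m \<ge> 2 \<longrightarrow> hankel_negative_definite (m - 2) (R_tilde F))
        \<longleftrightarrow> (\<forall>y. (\<exists>c<m - 1. y c \<noteq> 0) \<longrightarrow> hankel_form (m - 1) 0 y < 0)"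
    proof (cases "m \<ge> 2")
      case True
      then have "Suc (m - 2) = m - 1" by simp
      moreover have "block_hankel (R_tilde F) = (\<lambda>(a, i) (b, j). s (int (a + b)) $ i $ j)"
        by (simp add: block_hankel_def s_def)
      ultimately show ?thesis
        using True negative_definite_iff[of "\<lambda>j. s (int j)" "m - 2"]
        by (simp add: hankel_negative_definite_def hankel_form_def s_selfadjoint)
    qed (use assms(1) in auto)
    moreover have "(\<exists>L. (rm_eval (R_tilde_z F) \<longlongrightarrow> L) at_infinity \<and> negative_definite UNIV (\<lambda>i j. L $ i $ j))
        \<longleftrightarrow> (\<forall>v. v \<noteq> 0 \<longrightarrow> Re (herm_inner v (s (-2) *v v)) > 0)"
    proof -
      have "negative_definite UNIV (\<lambda>i j. (- s (-2)) $ i $ j) \<longleftrightarrow> (\<forall>v. v \<noteq> 0 \<longrightarrow> Re (herm_inner v (s (-2) *v v)) > 0)"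
        by (subst negative_definite_matrix_iff) (simp_all add: neg herm_inner_minus s_selfadjoint)
      moreover have "(rm_eval (R_tilde_z F) \<longlongrightarrow> L) at_infinity \<longleftrightarrow> L = - s (-2)" for L
        using s_low lim by blast
      ultimately show ?thesis by (simp only: simp_thms)
    qed
    ultimately show ?thesis unfolding hurwitz positive_iff by simp
  next
    case False
    have "\<not> positive" using subleading_invertible False by blast
    moreover have "\<not> (rm_eval (R_tilde_z F) \<longlongrightarrow> L) at_infinity" for L
    proof
      assume "(rm_eval (R_tilde_z F) \<longlongrightarrow> L) at_infinity"
      then have low: "s j = 0" if "j < -2" for j using that lim by blast
      obtain n where n: "m = Suc n" using assms(1) by (cases m) auto
      \<comment> \<open>The coefficient of \<open>z^m\<close> in \<open>W F_o = F_e\<close>, where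
        \<open>F_e\<close> has leading coefficient \<open>mat 1\<close>. A finite limit leaves only
        the summand with \<open>s (-2)\<close>, which is thus a left inverse of the leading
        coefficient of \<open>F_o\<close>.\<close>
      have "v = s (-2) *v (f (2 * m - 1) *v v)" for v
      proof -
        have "v = (\<Sum>k<m. s (int k - int m - 1) *v (f (2 * k + 1) *v v))"
          using quotient[of "int m" v] f by simp
        also have "\<dots> = s (-2) *v (f (2 * m - 1) *v v)"
          unfolding n by (simp add: low)
        finally show ?thesis .
      qed
      then have "invertible (f (2 * m - 1))"
        unfolding invertible_iff_ker by (metis matrix_vector_mult_0_right)
      with False show False by blast
    qed
    ultimately show ?thesis unfolding hurwitz by blast
  qed
qed

end
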